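(* Let $p=p_0=(0:\dots:0:1)\in\mathbb P^n$, let $\mathcal I_p\subset\mathcal O_p$ be an ideal defining a zero-dimensional scheme $\mathfrak Z$ concentrated at $p$, let $\alpha=\alpha(\mathfrak Z)$, and let $L'\subset\Gamma'$ be the inverse system of $\mathcal I_p$. Suppose that $V'\subset\Gamma'_{\le\alpha}$ generates $L'$ (i.e. $L'=R'\circ V'$). Denote by $I_{\mathfrak Z}\subset R$ the homogenization of $\mathcal I_p$ (the saturated ideal of $\mathfrak Z$), and by $V$ the subspace $\operatorname{Homog}(V',Z,\alpha)$ of $\Gamma_\alpha$. Then the inverse system $L_{\mathfrak Z}=(I_{\mathfrak Z})^{-1}\subset\Gamma$ satisfies, for every $j\ge0$, $$(L_{\mathfrak Z})_j=\operatorname{Homog}(L'_{\le\alpha},Z,j)=R_\alpha\circ\bigl(V\cdot_{rp}Z^{[j]}\bigr).$$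
   Context: $k$ is a field which is algebraically closed (or all support points are rational), of characteristic $0$ or larger than the degree of every form considered. $R=k[x_1,\dots,x_n,z]$ ($z=x_{n+1}$) is the coordinate ring of $\mathbb P^n$ and $\Gamma=k_{DP}[X_1,\dots,X_n,Z]$ ($Z=X_{n+1}$) the divided power ring, with product $X^{[U]}X^{[V]}=\binom{U+V}{U}X^{[U+V]}$; $R$ acts on $\Gamma$ by contraction, $x^K\circ X^{[U]}=X^{[U-K]}$ ($0$ if an exponent is negative). For a graded ideal $I$, $I^{-1}\subset\Gamma$ is the graded submodule annihilated by $I$. $R'=k[y_1,\dots,y_n]$ is the coordinate ring of $\mathbb A^n=\{x_{n+1}\ne0\}$ and $\Gamma'=k_{DP}[Y_1,\dots,Y_n]$ with the contraction action of $R'$. Since $\mathcal I_p$ contains a power of the maximal ideal, it corresponds to an ideal $J\subset R'$ concentrated at the origin, and its inverse system is $L'=J^{-1}=\{f\in\Gamma':h\circ f=0\ \forall h\in J\}$. $\alpha(\mathfrak Z)$ is the socle degree of $\mathcal O_p/\mathcal I_p$, i.e. the largest $i$ with $\mathfrak m^i\ne0$; equivalently the highest degree of an element of $L'$. For $f=\sum_i f_i\in\Gamma'$, $f_i\in\Gamma'_i$, and $u\ge0$, $\operatorname{Homog}(f,Z,u)=\sum_{0\le i\le u}f_i(X_1,\dots,X_n)Z^{[u-i]}$, and $\operatorname{Homog}(S,Z,u)$ is the span of these for $f\in S$. The raised-power product $\cdot_{rp}Z^{[u]}$ is the linear map on $\Gamma$ sending a monomial $X_1^{[u_1]}\cdots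 X_n^{[u_n]}Z^{[m]}$ to $X_1^{[u_1]}\cdots X_n^{[u_n]}Z^{[m+u]}$. *)

theory Defs
  imports Complex_Main "HOL-Library.Poly_Mapping" "HOL-Computational_Algebra.Fraction_Field"
begin

text \<open>
  The coordinates of affine \<open>n\<close>-space are indexed by a finite linearly ordered type \<open>'n\<close>; those of
  projective \<open>n\<close>-space by \<open>'n option\<close>, with \<^term>\<open>Some i\<close> for \<open>x\<^sub>i\<close> and \<^term>\<open>None\<close> for the extra
  coordinate \<open>z\<close>.  Exponent vectors are finitely supported functions.  The order on \<open>'n\<close> serves only
  to make the polynomial ring an instance of class \<^class>\<open>idom\<close>, as needed for \<^typ>\<open>'a fract\<close>.
\<close>

abbreviation lookup :: "('a \<Rightarrow>\<^sub>0 'b::zero) \<Rightarrow> 'a \<Rightarrow> 'b" where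
  "lookup \<equiv> Poly_Mapping.lookup"

abbreviation keys :: "('a \<Rightarrow>\<^sub>0 'b::zero) \<Rightarrow> 'a set" where
  "keys \<equiv> Poly_Mapping.keys"

type_synonym 'v expo = "'v \<Rightarrow>\<^sub>0 nat"

type_synonym ('v, 'k) mpoly = "'v expo \<Rightarrow>\<^sub>0 'k"

text \<open>
  An element of the divided power ring is represented by its coefficients with respect to the
  divided monomials \<open>X\<^bsup>[U]\<^esup>\<close>.  The ring multiplication on this type is that of polynomials; the one
  of the divided power ring is \<open>dp_mult\<close> below.
\<close>

type_synonym ('v, 'k) dpoly = "'v expo \<Rightarrow>\<^sub>0 'k"

definition expo_deg :: "'v expo \<Rightarrow> nat" where
  "expo_deg U = (\<Sum>v\<in>keys U. lookup U v)"

definition forms :: "nat \<Rightarrow> ('v expo \<Rightarrow>\<^sub>0 'k::zero) set" where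
  "forms d = {f. \<forall>U\<in>keys f. expo_deg U = d}"

definition degree_le :: "nat \<Rightarrow> ('v expo \<Rightarrow>\<^sub>0 'k::zero) set" where
  "degree_le d = {f. \<forall>U\<in>keys f. expo_deg U \<le> d}"

definition component :: "nat \<Rightarrow> ('v expo \<Rightarrow>\<^sub>0 'k::comm_monoid_add) \<Rightarrow> 'v expo \<Rightarrow>\<^sub>0 'k" where
  "component d f = (\<Sum>U\<in>{U\<in>keys f. expo_deg U = d}. Poly_Mapping.single U (lookup f U))"


subsection \<open>Ideals\<close>

global_interpretation ideal: module "(*) :: 'a::comm_ring_1 \<Rightarrow> 'a \<Rightarrow> 'a"
  by unfold_locales (simp_all add: algebra_simps)

definition prime_ideal :: "'a::comm_ring_1 set \<Rightarrow> bool" where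
  "prime_ideal P \<longleftrightarrow> ideal.subspace P \<and> P \<noteq> UNIV \<and> (\<forall>a b. a * b \<in> P \<longrightarrow> a \<in> P \<or> b \<in> P)"

primrec ideal_power :: "'a::comm_ring_1 set \<Rightarrow> nat \<Rightarrow> 'a set" where
  "ideal_power I 0 = UNIV"
| "ideal_power I (Suc i) = ideal.span {a * b | a b. a \<in> I \<and> b \<in> ideal_power I i}"


subsection \<open>The local ring at the point\<close>

text \<open>
  The local ring of \<open>\<bbbP>\<^sup>n\<close> at \<open>(0:\<dots>:0:1)\<close>, computed in the chart \<open>z \<noteq> 0\<close> with
  coordinates \<open>y\<^sub>i = x\<^sub>i / z\<close>: the fractions whose denominator does not vanish at the origin, that is,
  has nonzero constant coefficient.
\<close>

typedef (overloaded) ('n, 'k) local_ring =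
  "{Fract f g | f g. lookup g 0 \<noteq> 0} :: ('n::{finite,linorder}, 'k::field) mpoly fract set"
  by (rule exI[of _ "Fract 0 1"]) force

setup_lifting type_definition_local_ring

lemma lookup_mult_0:
  fixes f g :: "('v, 'k::field) mpoly"
  shows "lookup (f * g) 0 = lookup f 0 * lookup g 0"
proof -
  have split0: "(0 = l + q) \<longleftrightarrow> l = 0 \<and> q = 0" for l q :: "'v expo"
  proof
    assume eq: "0 = l + q"
    have "lookup l v = 0 \<and> lookup q v = 0" for v
      using arg_cong[OF eq, of "\<lambda>h. lookup h v"] by (simp add: lookup_add)
    then show "l = 0 \<and> q = 0"
      by (simp add: poly_mapping_eq_iff fun_eq_iff)
  qed simp
  have "(\<Sum>q. lookup g q when (0::'v expo) = l + q) = (lookup g 0 when l = 0)" for l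
    by (cases "l = 0") (simp_all add: split0)
  then show ?thesis
    by (simp add: lookup_mult mult_when)
qed

instantiation local_ring :: ("{finite,linorder}", field) comm_ring_1
begin

lift_definition zero_local_ring :: "('a, 'b) local_ring" is 0
  unfolding Zero_fract_def by force

lift_definition one_local_ring :: "('a, 'b) local_ring" is 1
  unfolding One_fract_def by force

lift_definition plus_local_ring :: "('a, 'b) local_ring \<Rightarrow> ('a, 'b) local_ring \<Rightarrow> ('a, 'b) local_ring"
  is "(+)"
proof clarsimp
  fix f g f' g' :: "('a, 'b) mpoly"
  assume g: "lookup g 0 \<noteq> 0" "lookup g' 0 \<noteq> 0"
  then have "g \<noteq> 0" "g' \<noteq> 0" by auto
  with g show "\<exists>h e. Fract f g + Fract f' g' = Fract h e \<and> lookup e 0 \<noteq> 0"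
    by (intro exI[of _ "f * g' + f' * g"] exI[of _ "g * g'"]) (simp add: lookup_mult_0)
qed

lift_definition uminus_local_ring :: "('a, 'b) local_ring \<Rightarrow> ('a, 'b) local_ring"
  is uminus
proof clarsimp
  fix f g :: "('a, 'b) mpoly"
  assume "lookup g 0 \<noteq> 0"
  then show "\<exists>h e. Fract (- f) g = Fract h e \<and> lookup e 0 \<noteq> 0"
    by (intro exI[of _ "- f"] exI[of _ g]) simp
qed

lift_definition minus_local_ring :: "('a, 'b) local_ring \<Rightarrow> ('a, 'b) local_ring \<Rightarrow> ('a, 'b) local_ring"
  is "(-)"
proof clarsimp
  fix f g f' g' :: "('a, 'b) mpoly"
  assume g: "lookup g 0 \<noteq> 0" "lookup g' 0 \<noteq> 0"
  then have "g \<noteq> 0" "g' \<noteq> 0" by auto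
  with g show "\<exists>h e. Fract f g - Fract f' g' = Fract h e \<and> lookup e 0 \<noteq> 0"
    by (intro exI[of _ "f * g' - f' * g"] exI[of _ "g * g'"]) (simp add: lookup_mult_0)
qed

lift_definition times_local_ring :: "('a, 'b) local_ring \<Rightarrow> ('a, 'b) local_ring \<Rightarrow> ('a, 'b) local_ring"
  is "(*)"
proof clarsimp
  fix f g f' g' :: "('a, 'b) mpoly"
  assume "lookup g 0 \<noteq> 0" "lookup g' 0 \<noteq> 0"
  then show "\<exists>h e. Fract (f * f') (g * g') = Fract h e \<and> lookup e 0 \<noteq> 0"
    by (intro exI[of _ "f * f'"] exI[of _ "g * g'"]) (simp add: lookup_mult_0)
qed

instance
proof
  fix a b c :: "('a, 'b) local_ring"
  note rep = zero_local_ring.rep_eq one_local_ring.rep_eq plus_local_ring.rep_eq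
    uminus_local_ring.rep_eq minus_local_ring.rep_eq times_local_ring.rep_eq
  note eqI = Rep_local_ring_inject[THEN iffD1]
  show "a * b * c = a * (b * c)" by (rule eqI, unfold rep, rule mult.assoc)
  show "a * b = b * a" by (rule eqI, unfold rep, rule mult.commute)
  show "1 * a = a" by (rule eqI, unfold rep, rule mult_1_left)
  show "a + b + c = a + (b + c)" by (rule eqI, unfold rep, rule add.assoc)
  show "a + b = b + a" by (rule eqI, unfold rep, rule add.commute)
  show "0 + a = a" by (rule eqI, unfold rep, rule add_0_left)
  show "- a + a = 0" by (rule eqI, unfold rep, rule left_minus)
  show "a - b = a + - b" by (rule eqI, unfold rep, rule diff_conv_add_uminus)
  show "(a + b) * c = a * c + b * c" by (rule eqI, unfold rep, rule distrib_right)
  show "(0 :: ('a, 'b) local_ring) \<noteq> 1" 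
  proof
    assume "(0 :: ('a, 'b) local_ring) = 1"
    then have "Rep_local_ring (0 :: ('a, 'b) local_ring) = Rep_local_ring 1"
      by (rule arg_cong)
    then show False
      unfolding rep by (rule zero_neq_one[THEN notE])
  qed
qed

end

definition to_local :: "('n::{finite,linorder}, 'k::field) mpoly \<Rightarrow> ('n, 'k) local_ring" where
  "to_local f = Abs_local_ring (Fract f 1)"

text \<open>The maximal ideal of a local ring consists of its nonunits.\<close>

definition max_ideal :: "('n::{finite,linorder}, 'k::field) local_ring set" where
  "max_ideal = {a. \<not> a dvd 1}"

text \<open>
  The subscheme defined by an ideal of the local ring is zero-dimensional and concentrated at the
  point if the closed point is the only element of its support.
\<close>

definition zero_dim_at_point :: "('n::{finite,linorder}, 'k::field) local_ring set \<Rightarrow> bool" where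
  "zero_dim_at_point I \<longleftrightarrow> ideal.subspace I \<and> {P. prime_ideal P \<and> I \<subseteq> P} = {max_ideal}"

text \<open>The image of \<open>\<mm>\<^sup>i\<close> in the quotient by \<open>I\<close> is nonzero iff \<open>\<mm>\<^sup>i\<close> is not contained in \<open>I\<close>.\<close>

definition socle_degree :: "('n::{finite,linorder}, 'k::field) local_ring set \<Rightarrow> nat" where
  "socle_degree I = (GREATEST i. \<not> ideal_power max_ideal i \<subseteq> I)"

definition affine_ideal ::
  "('n::{finite,linorder}, 'k::field) local_ring set \<Rightarrow> ('n, 'k) mpoly set" where
  "affine_ideal I = {h. to_local h \<in> I}"


subsection \<open>Homogenization of ideals\<close>

definition embed_expo :: "'n::finite expo \<Rightarrow> 'n option expo" where
  "embed_expo U = (\<Sum>i\<in>UNIV. Poly_Mapping.single (Some i) (lookup U i))"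

definition poly_deg :: "('v, 'k::zero) mpoly \<Rightarrow> nat" where
  "poly_deg f = Max (insert 0 (expo_deg ` keys f))"

text \<open>\<open>z\<^bsup>deg f\<^esup> f(x\<^sub>1/z, \<dots>, x\<^sub>n/z)\<close>\<close>

definition homog_poly :: "('n::finite, 'k::field) mpoly \<Rightarrow> ('n option, 'k) mpoly" where
  "homog_poly f = (\<Sum>U\<in>keys f.
     Poly_Mapping.single (embed_expo U + Poly_Mapping.single None (poly_deg f - expo_deg U)) (lookup f U))"

definition homog_ideal ::
  "('n::{finite,linorder}, 'k::field) local_ring set \<Rightarrow> ('n option, 'k) mpoly set" where
  "homog_ideal I = ideal.span (homog_poly ` affine_ideal I)"


subsection \<open>Divided powers and contraction\<close>

definition dp_scale :: "'k::field \<Rightarrow> ('v, 'k) dpoly \<Rightarrow> ('v, 'k) dpoly" where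
  "dp_scale c f = Poly_Mapping.map ((*) c) f"

lemma lookup_dp_scale: "lookup (dp_scale c f) U = c * lookup f U"
  by (simp add: dp_scale_def Poly_Mapping.map.rep_eq when_def)

global_interpretation dp: vector_space "dp_scale :: 'k::field \<Rightarrow> ('v, 'k) dpoly \<Rightarrow> ('v, 'k) dpoly"
proof
  fix a b :: 'k and f g :: "('v, 'k) dpoly"
  show "dp_scale a (f + g) = dp_scale a f + dp_scale a g"
    by (rule poly_mapping_eqI) (simp add: lookup_dp_scale lookup_add distrib_left)
  show "dp_scale (a + b) f = dp_scale a f + dp_scale b f"
    by (rule poly_mapping_eqI) (simp add: lookup_dp_scale lookup_add distrib_right)
  show "dp_scale a (dp_scale b f) = dp_scale (a * b) f"
    by (rule poly_mapping_eqI) (simp add: lookup_dp_scale)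
  show "dp_scale 1 f = f"
    by (rule poly_mapping_eqI) (simp add: lookup_dp_scale)
qed

definition expo_binomial :: "'v expo \<Rightarrow> 'v expo \<Rightarrow> nat" where
  "expo_binomial W U = (\<Prod>v\<in>keys W. lookup W v choose lookup U v)"

definition dp_mult :: "('v, 'k::field) dpoly \<Rightarrow> ('v, 'k) dpoly \<Rightarrow> ('v, 'k) dpoly" where
  "dp_mult f g = (\<Sum>U\<in>keys f. \<Sum>V\<in>keys g.
     Poly_Mapping.single (U + V) (of_nat (expo_binomial (U + V) U) * lookup f U * lookup g V))"

text \<open>
  The divisibility of exponents is spelled out since \<open>\<le>\<close> on finitely supported functions is
  lexicographic.
\<close>

definition contract :: "('v, 'k::field) mpoly \<Rightarrow> ('v, 'k) dpoly \<Rightarrow> ('v, 'k) dpoly" where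
  "contract h f = (\<Sum>K\<in>keys h. \<Sum>U\<in>keys f.
     if \<forall>v. lookup K v \<le> lookup U v then Poly_Mapping.single (U - K) (lookup h K * lookup f U) else 0)"

definition contract_span :: "('v, 'k::field) mpoly set \<Rightarrow> ('v, 'k) dpoly set \<Rightarrow> ('v, 'k) dpoly set" where
  "contract_span H S = dp.span {contract h f | h f. h \<in> H \<and> f \<in> S}"

definition inverse_system :: "('v, 'k::field) mpoly set \<Rightarrow> ('v, 'k) dpoly set" where
  "inverse_system I = {f. \<forall>h\<in>I. contract h f = 0}"

text \<open>The substitution \<open>Y\<^sub>i \<mapsto> X\<^sub>i\<close>.\<close>

definition embed_dp :: "('n::finite, 'k::field) dpoly \<Rightarrow> ('n option, 'k) dpoly" where
  "embed_dp f = (\<Sum>U\<in>keys f. Poly_Mapping.single (embed_expo U) (lookup f U))"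

definition Z_power :: "nat \<Rightarrow> ('n option, 'k::field) dpoly" where
  "Z_power m = Poly_Mapping.single (Poly_Mapping.single None m) 1"

definition Homog :: "nat \<Rightarrow> ('n::finite, 'k::field) dpoly \<Rightarrow> ('n option, 'k) dpoly" where
  "Homog u f = (\<Sum>i\<le>u. dp_mult (embed_dp (component i f)) (Z_power (u - i)))"

definition Homog_span :: "nat \<Rightarrow> ('n::finite, 'k::field) dpoly set \<Rightarrow> ('n option, 'k) dpoly set" where
  "Homog_span u S = dp.span (Homog u ` S)"

definition raise_Z :: "nat \<Rightarrow> ('n option, 'k::field) dpoly \<Rightarrow> ('n option, 'k) dpoly" where
  "raise_Z u f = (\<Sum>U\<in>keys f. Poly_Mapping.single (U + Poly_Mapping.single None u) (lookup f U))"

end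

theory Submission
  imports Defs
begin

text \<open>
  Let \<open>J \<subseteq> R'\<close> be the contraction of the local ideal \<open>\<I>\<^sub>p\<close> to the affine coordinate ring.  Everything
  rests on the pairing \<open>\<langle>h, f\<rangle>\<close>, the constant coefficient of \<open>h \<circ> f\<close>, for which the monomials and the
  divided monomials are dual bases.  The coefficient of \<open>h \<circ> f\<close> at \<open>Y\<^bsup>[K]\<^esup>\<close> is \<open>\<langle>y\<^sup>K h, f\<rangle>\<close>, so the
  inverse system of an ideal is its orthogonal complement (\<open>inverse_system_ideal_iff\<close>).

  The same computation in degree \<open>j\<close> shows that a form \<open>Homog(f, Z, j)\<close> is annihilated by the
  homogenization of \<open>J\<close> iff \<open>f\<close> is orthogonal to those elements of \<open>J\<close> that have degree at most \<open>j\<close>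
  (\<open>Homog_in_inverse_system_iff\<close>).  The question is therefore whether every \<open>f\<close> of degree at most \<open>j\<close>
  that is orthogonal to \<open>J \<inter> R'\<^sub>\<le>\<^sub>j\<close> is the truncation at degree \<open>j\<close> of an element of \<open>J\<^sup>\<bottom> = L'\<close>.
  This is linear algebra (\<open>inverse_system_truncation\<close>): the linear form \<open>\<langle>\<cdot>, f\<rangle>\<close> on \<open>R'\<^sub>\<le>\<^sub>j\<close> vanishes on
  \<open>J \<inter> R'\<^sub>\<le>\<^sub>j\<close>, hence extends to a linear form \<open>\<phi>\<close> on \<open>R'\<close> that vanishes on \<open>J\<close>.  Since \<open>J\<close> contains
  all monomials of degree greater than \<open>\<alpha>\<close>, the values of \<open>\<phi>\<close> on monomials are the coefficients of
  an element of \<open>\<Gamma>'\<^sub>\<le>\<^sub>\<alpha>\<close>.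

  That \<open>J\<close> contains these monomials follows from commutative algebra in the local ring
  (\<open>single_in_affine_ideal\<close>).  The maximal ideal \<open>\<mm>\<close> is the only prime ideal containing \<open>\<I>\<^sub>p\<close>, so each
  variable is nilpotent modulo \<open>\<I>\<^sub>p\<close>; as \<open>\<mm>\<close> is generated by the finitely many variables, some power
  of it lies in \<open>\<I>\<^sub>p\<close>.  Thus the socle degree is a genuine maximum, and \<open>\<mm>\<^bsup>\<alpha>+1\<^esup> \<subseteq> \<I>\<^sub>p\<close>.

  The second equality comes from the compatibility of homogenization with contraction: a form of
  degree \<open>\<alpha>\<close> is the homogenization \<open>h\<^sup>*\<close> of some \<open>h \<in> R'\<^sub>\<le>\<^sub>\<alpha>\<close>, and
  \<open>h\<^sup>* \<circ> Homog(f, Z, \<alpha> + j) = Homog(h \<circ> f, Z, j)\<close> (\<open>contract_Homog\<close>), while raising by \<open>Z\<^bsup>[j]\<^esup>\<close> turns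
  \<open>Homog(f, Z, \<alpha>)\<close> into \<open>Homog(f, Z, \<alpha> + j)\<close> for \<open>f\<close> of degree at most \<open>\<alpha>\<close>.
\<close>

text \<open>
  For a ring acting on itself this rule reads \<open>a (b c) = (a b) c\<close>, and rewriting with it and with the
  associative law does not terminate.
\<close>

declare ideal.scale_scale [simp del]

section \<open>Exponents and coefficients\<close>

lemma sum_singles: "(\<Sum>U\<in>keys f. Poly_Mapping.single U (lookup f U)) = f"
  by (rule poly_mapping_eqI)
     (auto simp: lookup_sum lookup_single when_def in_keys_iff)

lemma expo_deg_superset:
  assumes "finite S" "keys U \<subseteq> S"
  shows "expo_deg U = (\<Sum>v\<in>S. lookup U v)"
  unfolding expo_deg_def using assms
  by (intro sum.mono_neutral_left) (auto simp: in_keys_iff)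

lemma finite_expo_deg_le: "finite {U :: 'v::finite expo. expo_deg U \<le> a}"
proof -
  let ?e = "Poly_Mapping.lookup :: 'v expo \<Rightarrow> _"
  have "?e ` {U. expo_deg U \<le> a} \<subseteq> {\<gamma>. \<forall>v. \<gamma> v \<in> {..a}}"
  proof clarify
    fix U :: "'v expo" and v :: 'v assume U: "expo_deg U \<le> a"
    have "lookup U v \<le> (\<Sum>v\<in>UNIV. lookup U v)" by (rule member_le_sum) auto
    also have "\<dots> = expo_deg U" by (rule expo_deg_superset[symmetric]) auto
    finally show "lookup U v \<le> a" using U by simp
  qed
  moreover have "finite {\<gamma> :: 'v \<Rightarrow> nat. \<forall>v. \<gamma> v \<in> {..a}}"
    using finite_set_of_finite_funs[of "UNIV :: 'v set" "{..a}" undefined] by simp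
  ultimately have "finite (?e ` {U. expo_deg U \<le> a})" by (rule finite_subset)
  then show ?thesis by (rule finite_imageD) (simp add: inj_on_def)
qed

lemma expo_deg_add: "expo_deg (U + V) = expo_deg U + expo_deg V"
proof -
  let ?S = "keys U \<union> keys V"
  have "keys (U + V) \<subseteq> ?S" by (rule Poly_Mapping.keys_add)
  then have "expo_deg (U + V) = (\<Sum>v\<in>?S. lookup (U + V) v)" by (intro expo_deg_superset) auto
  moreover have "expo_deg U = (\<Sum>v\<in>?S. lookup U v)" by (intro expo_deg_superset) auto
  moreover have "expo_deg V = (\<Sum>v\<in>?S. lookup V v)" by (intro expo_deg_superset) auto
  ultimately show ?thesis by (simp add: lookup_add sum.distrib)
qed

lemma expo_deg_single [simp]: "expo_deg (Poly_Mapping.single v m) = m"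
  by (simp add: expo_deg_def)

lemma expo_deg_zero [simp]: "expo_deg 0 = 0"
  by (simp add: expo_deg_def)

lemma expo_deg_eq_0_iff: "expo_deg U = 0 \<longleftrightarrow> U = 0"
proof
  assume "expo_deg U = 0"
  then have "\<forall>v\<in>keys U. lookup U v = 0" by (simp add: expo_deg_def)
  then show "U = 0" by (intro poly_mapping_eqI) (auto simp: in_keys_iff)
qed simp

lemma expo_minus_add:
  fixes K U :: "'v expo"
  assumes "\<forall>v. lookup K v \<le> lookup U v"
  shows "U - K + K = U"
  by (rule poly_mapping_eqI) (simp add: lookup_add lookup_minus assms)

text \<open>
  Setting \<open>z = 1\<close> on monomials.  Together with the total degree, the affine part determines an
  exponent, so forms of degree \<open>j\<close> correspond to polynomials of degree at most \<open>j\<close>.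
\<close>

definition aff_expo :: "'n::finite option expo \<Rightarrow> 'n expo" where
  "aff_expo W = Poly_Mapping.map_key Some W"

lemma lookup_aff_expo [simp]: "lookup (aff_expo W) i = lookup W (Some i)"
  by (simp add: aff_expo_def map_key.rep_eq)

lemma lookup_embed_expo_Some [simp]: "lookup (embed_expo U) (Some i) = lookup U i"
  by (simp add: embed_expo_def lookup_sum lookup_single when_def)

lemma lookup_embed_expo_None [simp]: "lookup (embed_expo U) None = 0"
  by (simp add: embed_expo_def lookup_sum lookup_single when_def)

lemma aff_expo_add: "aff_expo (V + W) = aff_expo V + aff_expo W"
  by (rule poly_mapping_eqI) (simp add: lookup_add)

lemma aff_embed_expo [simp]: "aff_expo (embed_expo U + Poly_Mapping.single None m) = U"
  by (rule poly_mapping_eqI) (simp add: lookup_add lookup_single)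

lemma embed_aff_expo: "embed_expo (aff_expo W) + Poly_Mapping.single None (lookup W None) = W"
proof (rule poly_mapping_eqI)
  fix v show "lookup (embed_expo (aff_expo W) + Poly_Mapping.single None (lookup W None)) v = lookup W v"
    by (cases v) (simp_all add: lookup_add lookup_single)
qed

lemma expo_deg_embed [simp]: "expo_deg (embed_expo U) = expo_deg U"
proof -
  have "expo_deg (embed_expo U) = (\<Sum>v\<in>UNIV. lookup (embed_expo U) v)"
    by (rule expo_deg_superset) auto
  also have "\<dots> = (\<Sum>i\<in>UNIV. lookup U i)"
    by (simp add: UNIV_option_conv sum.reindex)
  also have "\<dots> = expo_deg U" by (rule expo_deg_superset[symmetric]) auto
  finally show ?thesis .
qed

lemma expo_deg_aff: "expo_deg (aff_expo W) + lookup W None = expo_deg W"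
  using arg_cong[OF embed_aff_expo[of W], of expo_deg] by (simp add: expo_deg_add)

lemma aff_expo_inj:
  assumes "aff_expo V = aff_expo W" "expo_deg V = expo_deg W"
  shows "V = W"
proof -
  have "lookup V None = lookup W None"
    using expo_deg_aff[of V] expo_deg_aff[of W] assms by simp
  then show ?thesis by (metis embed_aff_expo assms(1))
qed

section \<open>Contraction\<close>

text \<open>
  The truncated subtraction of exponents and the case distinction on divisibility disappear when
  the coefficients are read off instead of the monomials.
\<close>

lemma lookup_contract:
  "lookup (contract h f) W = (\<Sum>K\<in>keys h. lookup h K * lookup f (W + K))"
proof -
  have "(\<Sum>U\<in>keys f. lookup (if \<forall>v. lookup K v \<le> lookup U v
      then Poly_Mapping.single (U - K) (lookup h K * lookup f U) else 0) W) =
      lookup h K * lookup f (W + K)" (is "?L = _") for K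
  proof -
    have "lookup (if \<forall>v. lookup K v \<le> lookup U v
        then Poly_Mapping.single (U - K) (lookup h K * lookup f U) else 0) W =
        (if U = W + K then lookup h K * lookup f U else 0)" for U
    proof (cases "\<forall>v. lookup K v \<le> lookup U v")
      case True
      have "U - K = W \<longleftrightarrow> U = W + K"
        using expo_minus_add[OF True] by auto
      then show ?thesis using True by (simp add: lookup_single when_def)
    next
      case False
      then have "U \<noteq> W + K" by (auto simp: lookup_add)
      then show ?thesis using False by auto
    qed
    then have "?L = (\<Sum>U\<in>keys f. if U = W + K then lookup h K * lookup f U else 0)" by simp
    also have "\<dots> = lookup h K * lookup f (W + K)"
      by (simp add: in_keys_iff)
    finally show ?thesis .
  qed
  then show ?thesis unfolding contract_def by (simp add: lookup_sum)
qed

lemma lookup_contract_superset: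
  assumes "finite S" "keys h \<subseteq> S"
  shows "lookup (contract h f) W = (\<Sum>K\<in>S. lookup h K * lookup f (W + K))"
  unfolding lookup_contract using assms
  by (intro sum.mono_neutral_left) (auto simp: in_keys_iff)

lemma contract_add_left: "contract (g + h) f = contract g f + contract h f"
proof (rule poly_mapping_eqI)
  fix W
  let ?S = "keys g \<union> keys h"
  have "lookup (contract (g + h) f) W = (\<Sum>K\<in>?S. lookup (g + h) K * lookup f (W + K))"
    by (rule lookup_contract_superset) (auto simp: Poly_Mapping.keys_add)
  moreover have "lookup (contract g f) W = (\<Sum>K\<in>?S. lookup g K * lookup f (W + K))"
    by (rule lookup_contract_superset) auto
  moreover have "lookup (contract h f) W = (\<Sum>K\<in>?S. lookup h K * lookup f (W + K))"
    by (rule lookup_contract_superset) auto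
  ultimately show "lookup (contract (g + h) f) W = lookup (contract g f + contract h f) W"
    by (simp add: lookup_add sum.distrib algebra_simps)
qed

lemma contract_zero_left [simp]: "contract 0 f = 0"
  by (simp add: contract_def)

lemma contract_zero_right [simp]: "contract h 0 = 0"
  by (simp add: contract_def)

lemma contract_sum_left: "contract (\<Sum>i\<in>I. h i) f = (\<Sum>i\<in>I. contract (h i) f)"
  by (induction I rule: infinite_finite_induct) (simp_all add: contract_add_left)

lemma contract_scale_add_right:
  "contract h (dp_scale c f + g) = dp_scale c (contract h f) + contract h g"
proof (rule poly_mapping_eqI)
  fix W
  have "lookup h K * lookup (dp_scale c f + g) (W + K) =
      c * (lookup h K * lookup f (W + K)) + lookup h K * lookup g (W + K)" for K
    by (simp only: lookup_add lookup_dp_scale distrib_left mult.left_commute)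
  then show "lookup (contract h (dp_scale c f + g)) W =
      lookup (dp_scale c (contract h f) + contract h g) W"
    by (simp only: lookup_contract lookup_add[of "dp_scale c (contract h f)"] lookup_dp_scale
      sum.distrib sum_distrib_left)
qed

lemma lookup_contract_single:
  "lookup (contract (Poly_Mapping.single K c) f) W = c * lookup f (W + K)"
  using lookup_contract_superset[of "{K}" "Poly_Mapping.single K c" f W] by simp

lemma contract_single_mult:
  "contract (Poly_Mapping.single K c * h) f = contract (Poly_Mapping.single K c) (contract h f)"
proof -
  have "Poly_Mapping.single K c * h = Poly_Mapping.single K c * (\<Sum>U\<in>keys h. Poly_Mapping.single U (lookup h U))"
    by (simp add: sum_singles)
  also have "\<dots> = (\<Sum>U\<in>keys h. Poly_Mapping.single (K + U) (c * lookup h U))"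
    by (simp add: sum_distrib_left mult_single)
  finally have prod: "Poly_Mapping.single K c * h =
      (\<Sum>U\<in>keys h. Poly_Mapping.single (K + U) (c * lookup h U))" .
  show ?thesis
  proof (rule poly_mapping_eqI)
    fix W
    have "lookup (contract (Poly_Mapping.single K c * h) f) W =
        (\<Sum>U\<in>keys h. c * lookup h U * lookup f (W + (K + U)))"
      unfolding prod by (simp only: contract_sum_left lookup_sum lookup_contract_single)
    also have "\<dots> = c * lookup (contract h f) (W + K)"
      by (simp only: lookup_contract[of h] sum_distrib_left mult.assoc add.assoc)
    finally show "lookup (contract (Poly_Mapping.single K c * h) f) W =
        lookup (contract (Poly_Mapping.single K c) (contract h f)) W"
      by (simp only: lookup_contract_single)
  qed
qed

text \<open>\<open>\<Gamma>\<close> is an \<open>R\<close>-module, which reduces the annihilator of an ideal to its generators.\<close>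

lemma contract_mult: "contract (p * h) f = contract p (contract h f)"
proof -
  have "p * h = (\<Sum>K\<in>keys p. Poly_Mapping.single K (lookup p K) * h)"
    by (simp flip: sum_distrib_right add: sum_singles)
  then have "contract (p * h) f =
      (\<Sum>K\<in>keys p. contract (Poly_Mapping.single K (lookup p K)) (contract h f))"
    by (simp add: contract_sum_left contract_single_mult)
  also have "\<dots> = contract p (contract h f)"
    by (simp flip: contract_sum_left add: sum_singles)
  finally show ?thesis .
qed

lemma subspace_inverse_system: "dp.subspace (inverse_system I)"
proof (rule dp.subspaceI)
  show "0 \<in> inverse_system I" by (simp add: inverse_system_def)
  show "f + g \<in> inverse_system I" if "f \<in> inverse_system I" "g \<in> inverse_system I" for f g
    using that contract_scale_add_right[of _ 1 f g] by (simp add: inverse_system_def)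
  show "dp_scale c f \<in> inverse_system I" if "f \<in> inverse_system I" for c f
    using that contract_scale_add_right[of _ c f 0] by (simp add: inverse_system_def)
qed

lemma inverse_system_span: "inverse_system (ideal.span S) = inverse_system S"
proof
  show "inverse_system (ideal.span S) \<subseteq> inverse_system S"
    unfolding inverse_system_def using ideal.span_base by blast
  show "inverse_system S \<subseteq> inverse_system (ideal.span S)"
  proof
    fix f assume f: "f \<in> inverse_system S"
    have "contract h f = 0" if "h \<in> ideal.span S" for h
      using that
      by (induction rule: ideal.span_induct_alt)
         (use f in \<open>simp_all add: contract_add_left contract_mult inverse_system_def\<close>)
    then show "f \<in> inverse_system (ideal.span S)" by (simp add: inverse_system_def)
  qed
qed

text \<open>
  An ideal is closed under multiplication by \<open>x\<^sup>W\<close>, and the constant coefficient of \<open>(x\<^sup>W h) \<circ> f\<close> is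
  the coefficient of \<open>h \<circ> f\<close> at \<open>X\<^bsup>[W]\<^esup>\<close>.  So annihilation amounts to orthogonality for the pairing
  given by the constant coefficient.
\<close>

lemma inverse_system_ideal_iff:
  assumes "ideal.subspace J"
  shows "f \<in> inverse_system J \<longleftrightarrow> (\<forall>h\<in>J. lookup (contract h f) 0 = 0)"
proof
  assume perp: "\<forall>h\<in>J. lookup (contract h f) 0 = 0"
  have "contract h f = 0" if h: "h \<in> J" for h
  proof (rule poly_mapping_eqI)
    fix W
    have "Poly_Mapping.single W 1 * h \<in> J"
      using assms h by (rule ideal.subspace_scale)
    then have "lookup (contract (Poly_Mapping.single W 1 * h) f) 0 = 0" using perp by blast
    then show "lookup (contract h f) W = lookup 0 W"
      by (simp add: contract_mult lookup_contract_single)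
  qed
  then show "f \<in> inverse_system J" by (simp add: inverse_system_def)
qed (simp add: inverse_system_def)

section \<open>Homogenization\<close>

text \<open>
  The binomial coefficients in the divided power product become trivial when the two monomials have
  no variable in common, as is the case for \<open>X\<^bsup>[U]\<^esup>\<close> and \<open>Z\<^bsup>[m]\<^esup>\<close>.
\<close>

lemma expo_binomial_disjoint:
  assumes "\<And>v. lookup U v = 0 \<or> lookup V v = 0"
  shows "expo_binomial (U + V) U = 1"
proof -
  have "(lookup U v + lookup V v choose lookup U v) = 1" for v
    using assms[of v] by auto
  then show ?thesis unfolding expo_binomial_def by (simp add: lookup_add)
qed

lemma lookup_embed_dp_Z_power:
  "lookup (dp_mult (embed_dp f) (Z_power m)) W =
     (if lookup W None = m then lookup f (aff_expo W) else 0)"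
proof -
  have emb: "lookup (embed_dp f) V = (if lookup V None = 0 then lookup f (aff_expo V) else 0)" for V
  proof -
    have "embed_expo U = V \<longleftrightarrow> lookup V None = 0 \<and> U = aff_expo V" for U
      using embed_aff_expo[of V] aff_embed_expo[of U 0] by auto
    then have "lookup (embed_dp f) V =
        (\<Sum>U\<in>keys f. if U = aff_expo V then (if lookup V None = 0 then lookup f U else 0) else 0)"
      unfolding embed_dp_def lookup_sum by (intro sum.cong) (auto simp: lookup_single when_def)
    then show ?thesis by (simp add: in_keys_iff)
  qed
  have bin: "expo_binomial (U + Poly_Mapping.single None m) U = 1" if "U \<in> keys (embed_dp f)" for U
  proof (rule expo_binomial_disjoint)
    fix v show "lookup U v = 0 \<or> lookup (Poly_Mapping.single None m) v = 0"
      using that by (cases v) (auto simp: in_keys_iff emb lookup_single split: if_splits)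
  qed
  have "dp_mult (embed_dp f) (Z_power m) =
      (\<Sum>U\<in>keys (embed_dp f). Poly_Mapping.single (U + Poly_Mapping.single None m) (lookup (embed_dp f) U))"
    unfolding dp_mult_def Z_power_def by (intro sum.cong) (simp_all add: bin)
  also have "lookup \<dots> W = (\<Sum>U\<in>keys (embed_dp f).
      if U = embed_expo (aff_expo W) then (if lookup W None = m then lookup (embed_dp f) U else 0) else 0)"
    unfolding lookup_sum
  proof (intro sum.cong refl)
    fix U assume "U \<in> keys (embed_dp f)"
    then have "lookup U None = 0" by (auto simp: in_keys_iff emb split: if_splits)
    then have "U = embed_expo (aff_expo U)" by (metis add_0_right embed_aff_expo single_zero)
    then have "W = U + Poly_Mapping.single None m \<longleftrightarrow> U = embed_expo (aff_expo W) \<and> lookup W None = m"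
      by (metis \<open>lookup U None = 0\<close> add_0 aff_embed_expo embed_aff_expo lookup_add lookup_single_eq)
    then show "lookup (Poly_Mapping.single (U + Poly_Mapping.single None m) (lookup (embed_dp f) U)) W =
        (if U = embed_expo (aff_expo W) then (if lookup W None = m then lookup (embed_dp f) U else 0) else 0)"
      by (auto simp: lookup_single when_def)
  qed
  also have "\<dots> = (if lookup W None = m then lookup (embed_dp f) (embed_expo (aff_expo W)) else 0)"
    by (simp add: in_keys_iff)
  also have "lookup (embed_dp f) (embed_expo (aff_expo W)) = lookup f (aff_expo W)"
    using aff_embed_expo[of "aff_expo W" 0] by (simp add: emb)
  finally show ?thesis .
qed

lemma lookup_component: "lookup (component d f) U = (if expo_deg U = d then lookup f U else 0)"
proof -
  have "lookup (component d f) U =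
      (\<Sum>V\<in>{V\<in>keys f. expo_deg V = d}. if V = U then lookup f V else 0)"
    unfolding component_def lookup_sum by (intro sum.cong) (auto simp: lookup_single when_def)
  then show ?thesis by (auto simp: in_keys_iff)
qed

text \<open>
  The truncation at degree \<open>j\<close> is implicit: the affine part of an exponent of degree \<open>j\<close> has degree
  at most \<open>j\<close>.
\<close>

lemma lookup_Homog:
  "lookup (Homog j f) W = (if expo_deg W = j then lookup f (aff_expo W) else 0)"
proof -
  have eq: "expo_deg W = expo_deg (aff_expo W) + lookup W None" by (simp add: expo_deg_aff)
  have "lookup (Homog j f) W =
      (\<Sum>i\<le>j. if i = expo_deg (aff_expo W) then (if lookup W None = j - i then lookup f (aff_expo W) else 0) else 0)"
    unfolding Homog_def lookup_sum
    by (intro sum.cong) (auto simp: lookup_embed_dp_Z_power lookup_component)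
  also have "\<dots> = (if expo_deg W = j then lookup f (aff_expo W) else 0)"
    by (auto simp: eq)
  finally show ?thesis .
qed

text \<open>
  Polynomials and divided polynomials are both given by their coefficients, so the homogenization
  of a polynomial is an instance of \<open>Homog\<close>, and the next results apply to both factors of a
  contraction.
\<close>

lemma homog_poly_eq_Homog: "homog_poly h = Homog (poly_deg h) h"
proof (rule poly_mapping_eqI)
  fix W
  have "(embed_expo U + Poly_Mapping.single None (poly_deg h - expo_deg U) = W) \<longleftrightarrow>
      (U = aff_expo W \<and> expo_deg W = poly_deg h)" if "U \<in> keys h" for U
  proof -
    have "expo_deg U \<le> poly_deg h" using that by (auto simp: poly_deg_def)
    then have deg: "expo_deg (embed_expo U + Poly_Mapping.single None (poly_deg h - expo_deg U)) = poly_deg h"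
      by (simp add: expo_deg_add)
    show ?thesis
      using deg aff_expo_inj[of "embed_expo U + Poly_Mapping.single None (poly_deg h - expo_deg U)" W]
      by auto
  qed
  then have "lookup (homog_poly h) W =
      (\<Sum>U\<in>keys h. if U = aff_expo W then (if expo_deg W = poly_deg h then lookup h U else 0) else 0)"
    unfolding homog_poly_def lookup_sum by (intro sum.cong) (auto simp: lookup_single when_def)
  also have "\<dots> = lookup (Homog (poly_deg h) h) W"
    by (simp add: in_keys_iff lookup_Homog)
  finally show "lookup (homog_poly h) W = lookup (Homog (poly_deg h) h) W" .
qed

lemma degree_le_iff: "f \<in> degree_le d \<longleftrightarrow> (\<forall>U. d < expo_deg U \<longrightarrow> lookup f U = 0)"
  by (simp add: degree_le_def in_keys_iff Ball_def) (metis not_less)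

lemma poly_deg_le_iff: "poly_deg f \<le> d \<longleftrightarrow> f \<in> degree_le d"
  by (auto simp: poly_deg_def degree_le_def)

lemma subspace_degree_le: "dp.subspace (degree_le d)"
  by (rule dp.subspaceI) (simp_all add: degree_le_iff lookup_add lookup_dp_scale)

lemma forms_iff: "f \<in> forms d \<longleftrightarrow> (\<forall>U. expo_deg U \<noteq> d \<longrightarrow> lookup f U = 0)"
  by (auto simp: forms_def in_keys_iff)

lemma Homog_in_forms: "Homog j f \<in> forms j"
  by (simp add: forms_iff lookup_Homog)

lemma forms_eq_Homog:
  "(forms j :: ('n::finite option, 'k::field) dpoly set) = Homog j ` degree_le j"
proof
  show "Homog j ` degree_le j \<subseteq> (forms j :: ('n option, 'k) dpoly set)" by (auto simp: Homog_in_forms)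
  show "(forms j :: ('n option, 'k) dpoly set) \<subseteq> Homog j ` degree_le j"
  proof
    fix F :: "('n option, 'k) dpoly" assume F: "F \<in> forms j"
    define f where "f = (\<Sum>W\<in>keys F. Poly_Mapping.single (aff_expo W) (lookup F W))"
    have f: "lookup f (aff_expo W) = lookup F W" if W: "expo_deg W = j" for W
    proof -
      have "aff_expo V = aff_expo W \<longleftrightarrow> V = W" if "V \<in> keys F" for V
        using that F W aff_expo_inj[of V W] by (auto simp: forms_def)
      then have "lookup f (aff_expo W) = (\<Sum>V\<in>keys F. if V = W then lookup F V else 0)"
        unfolding f_def lookup_sum by (intro sum.cong) (auto simp: lookup_single when_def)
      then show ?thesis by (simp add: in_keys_iff)
    qed
    have "f \<in> degree_le j"
      unfolding f_def
    proof (rule dp.subspace_sum[OF subspace_degree_le])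
      fix W assume "W \<in> keys F"
      then have "expo_deg (aff_expo W) \<le> j"
        using F expo_deg_aff[of W] by (auto simp: forms_def)
      then show "Poly_Mapping.single (aff_expo W) (lookup F W) \<in> degree_le j"
        by (auto simp: degree_le_iff lookup_single when_def)
    qed
    moreover have "F = Homog j f"
      using F by (intro poly_mapping_eqI) (simp add: lookup_Homog f forms_iff)
    ultimately show "F \<in> Homog j ` degree_le j" by blast
  qed
qed

lemma Homog_scale_add: "Homog j (dp_scale c f + g) = dp_scale c (Homog j f) + Homog j g"
  by (rule poly_mapping_eqI) (simp add: lookup_Homog lookup_add lookup_dp_scale)

lemma linear_Homog:
  "Vector_Spaces.linear dp_scale dp_scale (Homog j :: ('n::finite, 'k::field) dpoly \<Rightarrow> _)"
  unfolding Vector_Spaces.linear_iff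
proof (intro conjI allI)
  fix c :: 'k and f g :: "('n, 'k) dpoly"
  show "Homog j (f + g) = Homog j f + Homog j g"
    using Homog_scale_add[of j 1 f g] by simp
  show "Homog j (dp_scale c f) = dp_scale c (Homog j f)"
    by (rule poly_mapping_eqI) (simp add: lookup_Homog lookup_dp_scale)
qed (rule dp.vector_space_axioms)+

lemma linear_contract: "Vector_Spaces.linear dp_scale dp_scale (contract h)"
  unfolding Vector_Spaces.linear_iff
proof (intro conjI allI)
  fix c f g
  show "contract h (f + g) = contract h f + contract h g"
    using contract_scale_add_right[of h 1 f g] by simp
  show "contract h (dp_scale c f) = dp_scale c (contract h f)"
    using contract_scale_add_right[of h c f 0] by simp
qed (rule dp.vector_space_axioms)+

text \<open>
  Taking affine parts is a bijection from the monomials of \<open>Homog d h\<close> to those of \<open>h\<close>, under which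
  the two contraction sums agree term by term.  The bound on the degree of \<open>h\<close> ensures that no
  monomial of \<open>h\<close> is lost.
\<close>

lemma lookup_contract_Homog:
  assumes h: "h \<in> degree_le d"
  shows "lookup (contract (Homog d h) (Homog e f)) W =
    (if expo_deg W + d = e then lookup (contract h f) (aff_expo W) else 0)"
proof -
  let ?H = "Homog d h"
  have K: "expo_deg K = d" if "K \<in> keys ?H" for K
    using that by (auto simp: in_keys_iff lookup_Homog split: if_splits)
  have bij: "bij_betw aff_expo (keys ?H) (keys h)"
  proof (rule bij_betw_imageI)
    show "inj_on aff_expo (keys ?H)" using K aff_expo_inj by (intro inj_onI) auto
    show "aff_expo ` keys ?H = keys h"
    proof
      show "aff_expo ` keys ?H \<subseteq> keys h"
        by (auto simp: in_keys_iff lookup_Homog split: if_splits)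
      show "keys h \<subseteq> aff_expo ` keys ?H"
      proof
        fix U assume U: "U \<in> keys h"
        let ?W = "embed_expo U + Poly_Mapping.single None (d - expo_deg U)"
        have "expo_deg ?W = d" using U h by (simp add: expo_deg_add degree_le_def)
        then have "?W \<in> keys ?H" using U by (simp add: in_keys_iff lookup_Homog)
        then show "U \<in> aff_expo ` keys ?H" by (metis aff_embed_expo image_eqI)
      qed
    qed
  qed
  have "lookup (contract ?H (Homog e f)) W =
      (\<Sum>K\<in>keys ?H. lookup h (aff_expo K) *
        (if expo_deg W + d = e then lookup f (aff_expo W + aff_expo K) else 0))"
    unfolding lookup_contract
    by (intro sum.cong) (simp_all add: lookup_Homog K expo_deg_add aff_expo_add)
  also have "\<dots> = (\<Sum>U\<in>keys h. lookup h U *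
        (if expo_deg W + d = e then lookup f (aff_expo W + U) else 0))"
    by (rule sum.reindex_bij_betw[OF bij])
  finally show ?thesis by (simp add: lookup_contract)
qed

lemma contract_Homog:
  assumes "h \<in> degree_le d"
  shows "contract (Homog d h) (Homog (d + j) f) = Homog j (contract h f)"
  by (rule poly_mapping_eqI) (auto simp: lookup_contract_Homog[OF assms] lookup_Homog)

lemma lookup_raise_Z:
  "lookup (raise_Z u f) W =
     (if u \<le> lookup W None then lookup f (W - Poly_Mapping.single None u) else 0)"
proof -
  have "U + Poly_Mapping.single None u = W \<longleftrightarrow>
      u \<le> lookup W None \<and> U = W - Poly_Mapping.single None u" for U
  proof
    assume "u \<le> lookup W None \<and> U = W - Poly_Mapping.single None u"
    then show "U + Poly_Mapping.single None u = W"
      by (metis (no_types, lifting) expo_minus_add le0 lookup_single_eq lookup_single_not_eq)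
  qed (auto simp: lookup_add)
  then have "lookup (raise_Z u f) W = (\<Sum>U\<in>keys f.
      if U = W - Poly_Mapping.single None u then (if u \<le> lookup W None then lookup f U else 0) else 0)"
    unfolding raise_Z_def lookup_sum by (intro sum.cong) (auto simp: lookup_single when_def)
  then show ?thesis by (simp add: in_keys_iff)
qed

text \<open>
  For \<open>f\<close> of larger degree the left-hand side would miss the components of degree between \<open>a + 1\<close> and
  \<open>a + j\<close>, which \<open>Homog a\<close> discards.
\<close>

lemma raise_Z_Homog:
  assumes "f \<in> degree_le a"
  shows "raise_Z j (Homog a f) = Homog (a + j) f"
proof (rule poly_mapping_eqI)
  fix W
  show "lookup (raise_Z j (Homog a f)) W = lookup (Homog (a + j) f) W"
  proof (cases "j \<le> lookup W None")
    case True
    then have W: "W - Poly_Mapping.single None j + Poly_Mapping.single None j = W"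
      by (intro expo_minus_add) (simp add: lookup_single when_def)
    have "aff_expo (W - Poly_Mapping.single None j) = aff_expo W"
      by (rule poly_mapping_eqI) (simp add: lookup_minus lookup_single)
    moreover have "expo_deg (W - Poly_Mapping.single None j) + j = expo_deg W"
      using arg_cong[OF W, of expo_deg] by (simp add: expo_deg_add)
    ultimately show ?thesis using True by (auto simp: lookup_raise_Z lookup_Homog)
  next
    case False
    then have "lookup f (aff_expo W) = 0" if "expo_deg W = a + j"
      using assms that expo_deg_aff[of W] by (simp add: degree_le_iff)
    then show ?thesis using False by (simp add: lookup_raise_Z lookup_Homog)
  qed
qed

section \<open>Prime ideals and products of ideals\<close>

text \<open>
  If no power of \<open>x\<close> lies in \<open>I\<close>, then an ideal that is maximal among those containing \<open>I\<close> and
  avoiding all powers of \<open>x\<close> exists by Zorn's lemma and is prime.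
\<close>

lemma power_mem_ideal_if_in_all_primes:
  fixes I :: "'a::comm_ring_1 set"
  assumes I: "ideal.subspace I"
    and x: "\<And>P. prime_ideal P \<Longrightarrow> I \<subseteq> P \<Longrightarrow> x \<in> P"
  shows "\<exists>N. x ^ N \<in> I"
proof (rule ccontr)
  assume none: "\<not> ?thesis"
  let ?A = "{Q. ideal.subspace Q \<and> I \<subseteq> Q \<and> (\<forall>N. x ^ N \<notin> Q)}"
  have "\<exists>M\<in>?A. \<forall>Q\<in>?A. M \<subseteq> Q \<longrightarrow> Q = M"
  proof (rule subset_Zorn_nonempty)
    show "?A \<noteq> {}" using I none by blast
    fix C assume C: "C \<noteq> {}" "subset.chain ?A C"
    then have mem: "ideal.subspace Q" "I \<subseteq> Q" "x ^ N \<notin> Q" if "Q \<in> C" for Q N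
      using that unfolding subset.chain_def by blast+
    have chain: "Q \<subseteq> R \<or> R \<subseteq> Q" if "Q \<in> C" "R \<in> C" for Q R
      using C(2) that unfolding subset_chain_def by blast
    have "ideal.subspace (\<Union>C)"
    proof (rule ideal.subspaceI)
      show "0 \<in> \<Union>C" using C(1) mem(1) ideal.subspace_0 by blast
      show "c * a \<in> \<Union>C" if "a \<in> \<Union>C" for c a
        using mem(1) that ideal.subspace_scale by blast
      fix a b assume "a \<in> \<Union>C" "b \<in> \<Union>C"
      then obtain Q R where QR: "Q \<in> C" "R \<in> C" "a \<in> Q" "b \<in> R" by blast
      then obtain S where "S \<in> C" "a \<in> S" "b \<in> S" using chain by blast
      then show "a + b \<in> \<Union>C" using ideal.subspace_add mem(1) by blast
    qed
    then show "\<Union>C \<in> ?A" using C(1) mem(2,3) by blast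
  qed
  then obtain M where "M \<in> ?A" and max': "\<forall>Q\<in>?A. M \<subseteq> Q \<longrightarrow> Q = M" by (elim bexE)
  then have M: "ideal.subspace M" "I \<subseteq> M" "x ^ N \<notin> M" for N
    by simp_all
  have max: "Q = M" if "ideal.subspace Q" "I \<subseteq> Q" "\<forall>N. x ^ N \<notin> Q" "M \<subseteq> Q" for Q
    using max' that by simp
  \<comment> \<open>By maximality, adjoining any further element to \<open>M\<close> captures a power of \<open>x\<close>.\<close>
  have power: "\<exists>N r. x ^ N - r * a \<in> M" if "a \<notin> M" for a
  proof -
    have sub: "M \<subseteq> ideal.span (insert a M)" "a \<in> ideal.span (insert a M)"
      using ideal.span_superset[of "insert a M"] by auto
    then have "\<not> (\<forall>N. x ^ N \<notin> ideal.span (insert a M))"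
      using max[of "ideal.span (insert a M)"] M(2) that ideal.subspace_span by blast
    moreover have "ideal.span M = M" using M(1) by (simp add: ideal.span_eq_iff)
    ultimately show ?thesis by (auto simp: ideal.span_breakdown_eq)
  qed
  have "prime_ideal M"
    unfolding prime_ideal_def
  proof (intro conjI allI impI)
    show "ideal.subspace M" by (rule M(1))
    show "M \<noteq> UNIV" using M(3) by blast
    fix a b assume ab: "a * b \<in> M"
    show "a \<in> M \<or> b \<in> M"
    proof (rule ccontr)
      assume "\<not> ?thesis"
      then obtain N r K s where *: "x ^ N - r * a \<in> M" "x ^ K - s * b \<in> M"
        using power[of a] power[of b] by blast
      have "x ^ (N + K) = x ^ K * (x ^ N - r * a) + r * a * (x ^ K - s * b) + r * s * (a * b)"
        by (simp add: power_add algebra_simps)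
      also have "\<dots> \<in> M"
        by (rule ideal.subspace_add[OF M(1) ideal.subspace_add[OF M(1)]])
           (rule ideal.subspace_scale[OF M(1)], fact)+
      finally show False using M(3) by blast
    qed
  qed
  then have "x \<in> M" using x M(2) by blast
  then show False using M(3)[of 1] by simp
qed

lemma mult_mem_span_products:
  fixes a b :: "'a::comm_ring_1"
  assumes "a \<in> ideal.span A" "b \<in> ideal.span B"
  shows "a * b \<in> ideal.span {x * y | x y. x \<in> A \<and> y \<in> B}" (is "_ \<in> ?S")
  using assms(1)
proof (induction rule: ideal.span_induct_alt)
  case (step c x y)
  have "x * b \<in> ?S"
    using assms(2)
  proof (induction rule: ideal.span_induct_alt)
    case (step d u v)
    have "d * (x * u) \<in> ?S"
      using step \<open>x \<in> A\<close> by (intro ideal.span_scale ideal.span_base) auto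
    then have "d * (x * u) + x * v \<in> ?S" using step by (intro ideal.span_add)
    moreover have "x * (d * u + v) = d * (x * u) + x * v" by (simp add: algebra_simps)
    ultimately show ?case by (simp only:)
  qed (simp add: ideal.span_zero)
  then have "c * (x * b) + y * b \<in> ?S" using step by (intro ideal.span_add[OF ideal.span_scale])
  moreover have "(c * x + y) * b = c * (x * b) + y * b" by (simp add: algebra_simps)
  ultimately show ?case by (simp only:)
qed (simp add: ideal.span_zero)

section \<open>The local ring at the origin\<close>

lemma Rep_to_local: "Rep_local_ring (to_local f) = Fract f 1"
  unfolding to_local_def by (rule Abs_local_ring_inverse) force

lemma to_local_add: "to_local (f + g) = to_local f + to_local g"
  by (simp add: Rep_local_ring_inject[symmetric] plus_local_ring.rep_eq Rep_to_local)

lemma to_local_mult: "to_local (f * g) = to_local f * to_local g"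
  by (simp add: Rep_local_ring_inject[symmetric] times_local_ring.rep_eq Rep_to_local)

lemma to_local_0: "to_local 0 = 0"
  by (simp add: Rep_local_ring_inject[symmetric] zero_local_ring.rep_eq Rep_to_local Zero_fract_def)

lemma to_local_1: "to_local 1 = 1"
  by (simp add: Rep_local_ring_inject[symmetric] one_local_ring.rep_eq Rep_to_local One_fract_def)

lemma to_local_sum: "to_local (\<Sum>i\<in>A. f i) = (\<Sum>i\<in>A. to_local (f i))"
  by (induction A rule: infinite_finite_induct) (simp_all add: to_local_0 to_local_add)

text \<open>
  A fraction is a unit iff its numerator has nonzero constant coefficient, since then it may be
  inverted.
\<close>

lemma max_ideal_eq:
  "(max_ideal :: ('n::{finite,linorder}, 'k::field) local_ring set) = {to_local f * u | f u. lookup f 0 = 0}"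
proof (intro set_eqI iffI)
  fix a :: "('n, 'k) local_ring"
  obtain f g where fg: "Rep_local_ring a = Fract f g" "lookup g 0 \<noteq> 0"
    using Rep_local_ring[of a] by auto
  then have g: "g \<noteq> 0" by auto
  define u :: "('n, 'k) local_ring" where "u = Abs_local_ring (Fract 1 g)"
  have u: "Rep_local_ring u = Fract 1 g"
    unfolding u_def by (rule Abs_local_ring_inverse) (use fg in blast)
  have a: "a = to_local f * u"
    by (simp add: Rep_local_ring_inject[symmetric] times_local_ring.rep_eq Rep_to_local u fg)
  {
    assume "a \<in> max_ideal"
    have "lookup f 0 = 0"
    proof (rule ccontr)
      assume f0: "lookup f 0 \<noteq> 0"
      then have f: "f \<noteq> 0" by auto
      define b :: "('n, 'k) local_ring" where "b = Abs_local_ring (Fract g f)"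
      have b: "Rep_local_ring b = Fract g f"
        unfolding b_def by (rule Abs_local_ring_inverse) (use f0 in blast)
      have "1 = a * b"
        using f g by (simp add: Rep_local_ring_inject[symmetric] times_local_ring.rep_eq
            one_local_ring.rep_eq b fg One_fract_def eq_fract mult.commute)
      then have "a dvd 1" by (rule dvdI)
      then show False using \<open>a \<in> max_ideal\<close> by (simp add: max_ideal_def)
    qed
    with a show "a \<in> {to_local f * u | f u. lookup f 0 = 0}" by blast
  }
  {
    assume "a \<in> {to_local f * u | f u. lookup f 0 = 0}"
    then obtain p v where pv: "a = to_local p * v" "lookup p 0 = 0" by blast
    show "a \<in> max_ideal"
      unfolding max_ideal_def mem_Collect_eq
    proof
      assume "a dvd 1"
      then obtain b where "1 = a * b" by (auto simp: dvd_def)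
      then have *: "1 = to_local p * (v * b)" using pv by (simp add: mult.assoc)
      obtain q r where qr: "Rep_local_ring (v * b) = Fract q r" "lookup r 0 \<noteq> 0"
        using Rep_local_ring[of "v * b"] by auto
      have "Fract 1 1 = Fract p 1 * Fract q r"
        using arg_cong[OF *, of Rep_local_ring]
        by (simp only: times_local_ring.rep_eq[of "to_local p"] one_local_ring.rep_eq
            One_fract_def Rep_to_local qr)
      moreover have "r \<noteq> 0" using qr by auto
      ultimately have "r = p * q" by (simp add: eq_fract)
      then show False using qr(2) pv(2) by (simp add: lookup_mult_0)
    qed
  }
qed

lemma zero_dim_max_ideal:
  fixes I :: "('n::{finite,linorder}, 'k::field) local_ring set"
  assumes "zero_dim_at_point I"
  shows "ideal.subspace I" "prime_ideal (max_ideal :: ('n, 'k) local_ring set)" "I \<subseteq> max_ideal"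
    "\<And>P. prime_ideal P \<Longrightarrow> I \<subseteq> P \<Longrightarrow> P = max_ideal"
  using assms unfolding zero_dim_at_point_def by blast+

abbreviation local_monom :: "'n expo \<Rightarrow> ('n::{finite,linorder}, 'k::field) local_ring" where
  "local_monom U \<equiv> to_local (Poly_Mapping.single U 1)"

lemma local_monom_add: "local_monom (U + V) = local_monom U * local_monom V"
  by (simp add: to_local_mult[symmetric] mult_single)

lemma local_monom_single_power:
  "local_monom (Poly_Mapping.single v m) = local_monom (Poly_Mapping.single v 1) ^ m"
proof (induction m)
  case (Suc m)
  have "Poly_Mapping.single v (Suc m) = Poly_Mapping.single v 1 + Poly_Mapping.single v m"
    by (simp flip: single_add)
  then show ?case using Suc by (simp only: local_monom_add power_Suc)
qed (simp add: to_local_1)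

lemma expo_split:
  fixes U :: "'v expo"
  assumes "lookup U v \<ge> m"
  shows "\<exists>U'. U = Poly_Mapping.single v m + U'"
proof
  show "U = Poly_Mapping.single v m + (U - Poly_Mapping.single v m)"
    using assms by (intro poly_mapping_eqI) (auto simp: lookup_add lookup_minus lookup_single when_def)
qed

lemma to_local_in_span:
  assumes "lookup f 0 = 0"
  shows "to_local f \<in> ideal.span {local_monom (Poly_Mapping.single v 1) | v. True}" (is "_ \<in> ?S")
proof -
  have "to_local (Poly_Mapping.single U (lookup f U)) \<in> ?S" if "U \<in> keys f" for U
  proof -
    have "U \<noteq> 0" using that assms by (auto simp: in_keys_iff)
    then obtain v where "lookup U v \<noteq> 0"
      by (metis poly_mapping_eqI lookup_zero)
    then obtain U' where U: "U = Poly_Mapping.single v 1 + U'" using expo_split[of 1 U v] by auto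
    have "to_local (Poly_Mapping.single U (lookup f U)) =
        to_local (Poly_Mapping.single U' (lookup f U)) * local_monom (Poly_Mapping.single v 1)"
      by (simp add: to_local_mult[symmetric] mult_single U add.commute)
    also have "\<dots> \<in> ?S" by (intro ideal.span_scale ideal.span_base) blast
    finally show ?thesis .
  qed
  then have "(\<Sum>U\<in>keys f. to_local (Poly_Mapping.single U (lookup f U))) \<in> ?S"
    by (intro ideal.span_sum)
  then show ?thesis by (simp add: to_local_sum[symmetric] sum_singles)
qed

text \<open>
  The maximal ideal is generated by the variables, so a product of \<open>i\<close> of its elements is a
  combination of monomials of degree \<open>i\<close>.
\<close>

lemma ideal_power_max_ideal_subset:
  "ideal_power (max_ideal :: ('n::{finite,linorder}, 'k::field) local_ring set) i \<subseteq>
     ideal.span {local_monom U | U. expo_deg U = i}"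
proof (induction i)
  case 0
  have "a \<in> ideal.span {local_monom U | U. expo_deg U = 0}" for a :: "('n, 'k) local_ring"
  proof -
    have "a * local_monom 0 \<in> ideal.span {local_monom U | U. expo_deg U = 0}"
      by (intro ideal.span_scale ideal.span_base) (auto simp: expo_deg_eq_0_iff)
    then show ?thesis by (simp add: to_local_1)
  qed
  then show ?case by blast
next
  case (Suc i)
  let ?L = "{local_monom (Poly_Mapping.single v 1) | v. True} :: ('n, 'k) local_ring set"
  let ?M = "\<lambda>i. {local_monom U | U. expo_deg U = i} :: ('n, 'k) local_ring set"
  have sub: "{x * y | x y. x \<in> ?L \<and> y \<in> ?M i} \<subseteq> ?M (Suc i)"
  proof clarify
    fix v and U :: "'n expo" assume "i = expo_deg U"
    then show "\<exists>W. local_monom (Poly_Mapping.single v 1) * local_monom U =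
        (local_monom W :: ('n, 'k) local_ring) \<and> expo_deg W = Suc (expo_deg U)"
      by (intro exI[of _ "Poly_Mapping.single v 1 + U"]) (simp add: local_monom_add expo_deg_add)
  qed
  have "a * b \<in> ideal.span (?M (Suc i))" if "a \<in> max_ideal" "b \<in> ideal_power max_ideal i" for a b
  proof -
    obtain f u where a: "a = to_local f * u" "lookup f 0 = 0"
      using \<open>a \<in> max_ideal\<close> unfolding max_ideal_eq by blast
    have "to_local f * b \<in> ideal.span {x * y | x y. x \<in> ?L \<and> y \<in> ?M i}"
      using that Suc.IH by (intro mult_mem_span_products to_local_in_span a) auto
    then have "to_local f * b \<in> ideal.span (?M (Suc i))" using ideal.span_mono[OF sub] by blast
    then have "u * (to_local f * b) \<in> ideal.span (?M (Suc i))" by (rule ideal.span_scale)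
    then show ?thesis using a by (simp add: ac_simps)
  qed
  then have "{a * b | a b. a \<in> max_ideal \<and> b \<in> ideal_power max_ideal i} \<subseteq> ideal.span (?M (Suc i))"
    by blast
  then show ?case
    by (simp del: ideal.span_eq_iff add: ideal.span_minimal)
qed

lemma variable_in_max_ideal:
  "(local_monom (Poly_Mapping.single v 1) :: ('n::{finite,linorder}, 'k::field) local_ring) \<in> max_ideal"
proof -
  have "Poly_Mapping.single v 1 \<noteq> (0 :: 'n expo)"
    by (metis expo_deg_single expo_deg_zero zero_neq_one)
  then have "lookup (Poly_Mapping.single (Poly_Mapping.single v 1) (1 :: 'k)) (0 :: 'n expo) = 0"
    by (simp add: lookup_single when_def)
  then have "(local_monom (Poly_Mapping.single v 1) :: ('n, 'k) local_ring) * 1 \<in> max_ideal"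
    unfolding max_ideal_eq by blast
  then show ?thesis by simp
qed

lemma local_monom_in_ideal_power:
  "i \<le> expo_deg U \<Longrightarrow>
    (local_monom U :: ('n::{finite,linorder}, 'k::field) local_ring) \<in> ideal_power max_ideal i"
proof (induction i arbitrary: U)
  case (Suc i)
  then have "U \<noteq> 0" by auto
  then obtain v where "lookup U v \<noteq> 0" by (metis poly_mapping_eqI lookup_zero)
  then obtain U' where U: "U = Poly_Mapping.single v 1 + U'" using expo_split[of 1 U v] by auto
  have "(local_monom U' :: ('n, 'k) local_ring) \<in> ideal_power max_ideal i"
    using Suc by (simp add: U expo_deg_add)
  then show ?case
    unfolding ideal_power.simps U local_monom_add
    using variable_in_max_ideal by (intro ideal.span_base) blast
qed simp

text \<open>
  Each variable is nilpotent modulo \<open>I\<close>, because it lies in the only prime ideal containing \<open>I\<close>.  If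
  \<open>y\<^sub>v\<^bsup>m v\<^esup> \<in> I\<close> for all \<open>v\<close>, then by the pigeonhole principle every monomial of degree at least
  \<open>\<Sum>\<^sub>v m v\<close> lies in \<open>I\<close>.
\<close>

lemma max_ideal_power_subset:
  fixes I :: "('n::{finite,linorder}, 'k::field) local_ring set"
  assumes "zero_dim_at_point I"
  shows "\<exists>N. \<forall>i\<ge>N. ideal_power max_ideal i \<subseteq> I"
proof -
  note I = zero_dim_max_ideal[OF assms]
  have "\<exists>m. local_monom (Poly_Mapping.single v m) \<in> I" for v
  proof -
    obtain m where "local_monom (Poly_Mapping.single v 1) ^ m \<in> I"
      using power_mem_ideal_if_in_all_primes[OF I(1)] I(4) variable_in_max_ideal by metis
    then have "local_monom (Poly_Mapping.single v m) \<in> I"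
      by (simp only: local_monom_single_power[of v m])
    then show ?thesis by blast
  qed
  then obtain m where m: "local_monom (Poly_Mapping.single v (m v)) \<in> I" for v by metis
  have "ideal_power max_ideal i \<subseteq> I" if i: "(\<Sum>v\<in>UNIV. m v) \<le> i" for i
  proof -
    have "local_monom U \<in> I" if U: "expo_deg U = i" for U
    proof -
      have "\<exists>v. m v \<le> lookup U v"
      proof (rule ccontr)
        assume "\<not> ?thesis"
        then have "(\<Sum>v\<in>UNIV. lookup U v) < (\<Sum>v\<in>UNIV. m v)"
          by (intro sum_strict_mono) (auto simp: not_le)
        moreover have "expo_deg U = (\<Sum>v\<in>UNIV. lookup U v)" by (rule expo_deg_superset) auto
        ultimately show False using i U by simp
      qed
      then obtain v where "m v \<le> lookup U v" ..
      from expo_split[OF this] obtain U' where U': "U = Poly_Mapping.single v (m v) + U'" ..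
      have "local_monom U' * local_monom (Poly_Mapping.single v (m v)) \<in> I"
        using I(1) m by (rule ideal.subspace_scale)
      then show ?thesis unfolding U' local_monom_add by (subst mult.commute)
    qed
    then have "ideal.span {local_monom U | U. expo_deg U = i} \<subseteq> I"
      using I(1) by (intro ideal.span_minimal) auto
    then show ?thesis using ideal_power_max_ideal_subset[of i] by blast
  qed
  then show ?thesis by blast
qed

lemma subspace_affine_ideal:
  assumes "ideal.subspace I"
  shows "ideal.subspace (affine_ideal I)"
  using assms
  by (intro ideal.subspaceI)
     (auto simp: affine_ideal_def to_local_0 to_local_add to_local_mult
       intro: ideal.subspace_0 ideal.subspace_add ideal.subspace_scale)

text \<open>
  The preceding bound makes the greatest element in the definition of the socle degree \<open>\<alpha>\<close> a genuine
  maximum, whence \<open>\<mm>\<^sup>i \<subseteq> I\<close> for all \<open>i > \<alpha>\<close>.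
\<close>

lemma single_in_affine_ideal:
  fixes I :: "('n::{finite,linorder}, 'k::field) local_ring set"
  assumes "zero_dim_at_point I" "socle_degree I < expo_deg U"
  shows "Poly_Mapping.single U c \<in> affine_ideal I"
proof -
  note I = zero_dim_max_ideal[OF assms(1)]
  obtain N where N: "\<And>i. N \<le> i \<Longrightarrow> ideal_power max_ideal i \<subseteq> I"
    using max_ideal_power_subset[OF assms(1)] by blast
  have "ideal_power max_ideal (expo_deg U) \<subseteq> I"
  proof (rule ccontr)
    assume "\<not> ?thesis"
    then have "expo_deg U \<le> socle_degree I"
      unfolding socle_degree_def
    proof (rule Greatest_le_nat[of _ _ N])
      show "i \<le> N" if "\<not> ideal_power max_ideal i \<subseteq> I" for i
        using that N[of i] nat_le_linear[of N i] by blast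
    qed
    then show False using assms(2) by simp
  qed
  then have "Poly_Mapping.single U 1 \<in> affine_ideal I"
    using local_monom_in_ideal_power[of "expo_deg U" U] by (auto simp: affine_ideal_def)
  then have "Poly_Mapping.single 0 c * Poly_Mapping.single U 1 \<in> affine_ideal I"
    using subspace_affine_ideal[OF I(1)] by (intro ideal.subspace_scale)
  then show ?thesis by (simp add: mult_single)
qed

section \<open>Truncation of the inverse system\<close>

text \<open>Extend a basis of \<open>S\<close> by \<open>a\<close> and prescribe values on the enlarged independent set.\<close>

lemma linear_form_vanishing_on:
  fixes S :: "('v, 'k::field) dpoly set"
  assumes S: "dp.subspace S" and a: "a \<notin> S"
  obtains \<phi> :: "('v, 'k) dpoly \<Rightarrow> 'k"
  where "\<And>x y. \<phi> (x + y) = \<phi> x + \<phi> y" "\<And>c x. \<phi> (dp_scale c x) = c * \<phi> x"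
    "\<And>x. x \<in> S \<Longrightarrow> \<phi> x = 0" "\<phi> a = 1"
proof -
  have k: "vector_space ((*) :: 'k \<Rightarrow> 'k \<Rightarrow> 'k)"
    by unfold_locales (simp_all add: algebra_simps)
  interpret vector_space_pair dp_scale "(*) :: 'k \<Rightarrow> 'k \<Rightarrow> 'k"
    unfolding vector_space_pair_def using k dp.vector_space_axioms by blast
  obtain B where B: "B \<subseteq> S" "dp.independent B" "S \<subseteq> dp.span B"
    using dp.maximal_independent_subset[of S] by blast
  have span: "dp.span B = S" using B S by (metis dp.span_subspace)
  then have "dp.independent (insert a B)" using a B(2) by (intro dp.independent_insertI) simp_all
  then obtain \<phi> where \<phi>: "Vector_Spaces.linear dp_scale (*) \<phi>"
    "\<forall>x\<in>insert a B. \<phi> x = (if x = a then 1 else 0)"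
    using linear_independent_extend[of "insert a B" "\<lambda>x. if x = a then 1 else 0"] by blast
  have add: "\<phi> (x + y) = \<phi> x + \<phi> y" and scale: "\<phi> (dp_scale c x) = c * \<phi> x" for x y c
    using \<phi>(1) by (simp_all add: Vector_Spaces.linear_iff)
  have "\<phi> x = 0" if "x \<in> S" for x
    using that unfolding span[symmetric]
  proof (induction rule: dp.span_induct_alt)
    case base
    show ?case using scale[of 0 0] by simp
  next
    case (step c x y)
    then have "x \<noteq> a" using a B(1) by blast
    then show ?case using step \<phi>(2) by (simp add: add scale)
  qed
  then show thesis using that[of \<phi>] add scale \<phi>(2) by simp
qed

text \<open>Scalars are constant polynomials, so ideals are vector subspaces.\<close>

lemma dp_scale_eq_mult: "dp_scale c h = Poly_Mapping.single 0 c * h"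
proof -
  have "Poly_Mapping.single 0 c * h = Poly_Mapping.single 0 c * (\<Sum>U\<in>keys h. Poly_Mapping.single U (lookup h U))"
    by (simp add: sum_singles)
  also have "\<dots> = (\<Sum>U\<in>keys h. Poly_Mapping.single U (c * lookup h U))"
    by (simp add: sum_distrib_left mult_single)
  also have "\<dots> = dp_scale c h"
    by (rule poly_mapping_eqI)
       (auto simp: lookup_sum lookup_single when_def lookup_dp_scale in_keys_iff)
  finally show ?thesis by simp
qed

lemma subspace_ideal: "ideal.subspace J \<Longrightarrow> dp.subspace J"
  by (rule dp.subspaceI)
     (simp_all add: ideal.subspace_0 ideal.subspace_add ideal.subspace_scale dp_scale_eq_mult)

text \<open>
  The pairing is the standard bilinear form on coefficients.  Its symmetry transfers linearity from
  one argument to the other.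
\<close>

lemma pairing_swap: "lookup (contract h f) 0 = lookup (contract f h) 0"
proof -
  have "(\<Sum>K\<in>keys h. lookup h K * lookup f K) = (\<Sum>K\<in>keys h \<union> keys f. lookup h K * lookup f K)"
    by (rule sum.mono_neutral_left) (auto simp: in_keys_iff)
  also have "\<dots> = (\<Sum>K\<in>keys f. lookup f K * lookup h K)"
    by (rule sum.mono_neutral_cong_right) (auto simp: in_keys_iff)
  finally show ?thesis by (simp add: lookup_contract)
qed

text \<open>
  Over a field, the annihilator of \<open>J \<inter> A\<close> in the dual of a subspace \<open>A\<close> is the restriction to \<open>A\<close> of
  the annihilator of \<open>J\<close>; here \<open>A\<close> is the space of polynomials of degree at most \<open>j\<close>.  Linear forms
  on the whole polynomial ring are given by possibly infinite divided power series, but one that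
  vanishes on \<open>J\<close> vanishes on all monomials of degree greater than \<open>a\<close> and thus is a divided
  polynomial.
\<close>

lemma inverse_system_truncation:
  fixes J :: "('v::finite, 'k::field) mpoly set"
  assumes J: "ideal.subspace J"
    and mono: "\<And>U c. a < expo_deg U \<Longrightarrow> Poly_Mapping.single U c \<in> J"
    and f: "f \<in> degree_le j"
    and perp: "\<And>h. h \<in> J \<Longrightarrow> h \<in> degree_le j \<Longrightarrow> lookup (contract h f) 0 = 0"
  obtains g where "g \<in> inverse_system J \<inter> degree_le a"
    "\<And>U. expo_deg U \<le> j \<Longrightarrow> lookup g U = lookup f U"
proof -
  define p where "p h = lookup (contract h f) 0" for h :: "('v, 'k) mpoly"
  have p_add: "p (x + y) = p x + p y" and p_scale: "p (dp_scale c x) = c * p x" for x y c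
    unfolding p_def
    using pairing_swap[of "dp_scale c x" f] pairing_swap[of x f]
      Vector_Spaces.linear_iff[THEN iffD1, OF linear_contract[of f]]
    by (simp_all add: contract_add_left lookup_add lookup_dp_scale)
  have p_single: "p (Poly_Mapping.single U c) = c * lookup f U" for U c
    by (simp add: p_def lookup_contract_single)
  have single_deg: "Poly_Mapping.single U c \<in> degree_le j" if "expo_deg U \<le> j" for U and c :: 'k
    using that by (auto simp: degree_le_iff lookup_single when_def)
  obtain \<phi> :: "('v, 'k) mpoly \<Rightarrow> 'k" where
    \<phi>_add: "\<And>x y. \<phi> (x + y) = \<phi> x + \<phi> y" and \<phi>_scale: "\<And>c x. \<phi> (dp_scale c x) = c * \<phi> x"
    and \<phi>_J: "\<And>h. h \<in> J \<Longrightarrow> \<phi> h = 0" and \<phi>_p: "\<And>h. h \<in> degree_le j \<Longrightarrow> \<phi> h = p h"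
  proof (cases "\<forall>h\<in>degree_le j. p h = 0")
    case True
    show ?thesis by (rule that[of "\<lambda>_. 0"]) (use True in auto)
  next
    case False
    then obtain b where b: "b \<in> degree_le j" "p b \<noteq> 0" by blast
    define e where "e = dp_scale (inverse (p b)) b"
    have e: "e \<in> degree_le j" "p e = 1"
      using b dp.subspace_scale[OF subspace_degree_le] by (auto simp: e_def p_scale)
    \<comment> \<open>\<open>p\<close> is determined by its kernel and its value \<open>1\<close> at \<open>e\<close>, so it suffices that \<open>\<phi>\<close> vanishes on
      \<open>J\<close> and on this kernel and takes the value \<open>1\<close> at \<open>e\<close>.\<close>
    define S where "S = {x + y | x y. x \<in> J \<and> y \<in> {h \<in> degree_le j. p h = 0}}"
    have "dp.subspace {h \<in> degree_le j. p h = 0}"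
      using p_scale[of 0 0] subspace_degree_le[of j]
      by (auto simp: dp.subspace_def p_add p_scale)
    then have S: "dp.subspace S"
      unfolding S_def using subspace_ideal[OF J] by (intro dp.subspace_sums)
    have "e \<notin> S"
    proof
      assume "e \<in> S"
      then obtain x y where xy: "e = x + y" "x \<in> J" "y \<in> degree_le j" "p y = 0"
        by (auto simp: S_def)
      then have "x = e - y" by simp
      then have "x \<in> degree_le j" using e(1) xy(3) dp.subspace_diff[OF subspace_degree_le] by blast
      then have "p x = 0" using perp xy(2) by (simp add: p_def)
      then show False using e(2) xy(1,4) by (simp add: p_add)
    qed
    from linear_form_vanishing_on[OF S this] obtain \<phi> :: "('v, 'k) mpoly \<Rightarrow> 'k" where
      \<phi>: "\<And>x y. \<phi> (x + y) = \<phi> x + \<phi> y" "\<And>c x. \<phi> (dp_scale c x) = c * \<phi> x"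
      "\<And>x. x \<in> S \<Longrightarrow> \<phi> x = 0" "\<phi> e = 1"
      by metis
    have p0: "p 0 = 0" using p_scale[of 0 0] by simp
    show ?thesis
    proof (rule that[of \<phi>])
      fix h assume "h \<in> J"
      then have "h + 0 \<in> S"
        unfolding S_def using p0 dp.subspace_0[OF subspace_degree_le] by blast
      then show "\<phi> h = 0" using \<phi>(3) by simp
    next
      fix h :: "('v, 'k) mpoly" assume h: "h \<in> degree_le j"
      define y where "y = dp_scale (- p h) e + h"
      have "y \<in> degree_le j"
        unfolding y_def using h e(1) subspace_degree_le[of j]
        by (intro dp.subspace_add dp.subspace_scale)
      moreover have "p y = 0" unfolding y_def p_add p_scale e(2) by simp
      moreover have "0 \<in> J" using J by (rule ideal.subspace_0)
      ultimately have "0 + y \<in> S" unfolding S_def by blast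
      then have "\<phi> y = 0" using \<phi>(3) by simp
      then show "\<phi> h = p h" unfolding y_def \<phi>(1,2,4) by simp
    qed (use \<phi> in auto)
  qed
  define g where "g = (\<Sum>U | expo_deg U \<le> a. Poly_Mapping.single U (\<phi> (Poly_Mapping.single U 1)))"
  have g: "lookup g U = \<phi> (Poly_Mapping.single U 1)" for U
  proof -
    have "lookup g U = (\<Sum>V | expo_deg V \<le> a. if V = U then \<phi> (Poly_Mapping.single V 1) else 0)"
      unfolding g_def lookup_sum by (intro sum.cong) (auto simp: lookup_single when_def)
    also have "\<dots> = (if expo_deg U \<le> a then \<phi> (Poly_Mapping.single U 1) else 0)"
      by (simp add: finite_expo_deg_le)
    also have "\<dots> = \<phi> (Poly_Mapping.single U 1)"
      using \<phi>_J mono[of U 1] by (auto simp: not_le)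
    finally show ?thesis .
  qed
  have "lookup (contract h g) 0 = \<phi> h" for h
  proof -
    have \<phi>_sum: "\<phi> (\<Sum>i\<in>A. x i) = (\<Sum>i\<in>A. \<phi> (x i))" for A :: "'v expo set" and x
      using \<phi>_scale[of 0 0] by (induction A rule: infinite_finite_induct) (simp_all add: \<phi>_add)
    have "lookup h U * \<phi> (Poly_Mapping.single U 1) = \<phi> (Poly_Mapping.single U (lookup h U))" for U
      by (simp flip: \<phi>_scale add: dp_scale_eq_mult mult_single)
    then have "lookup (contract h g) 0 = \<phi> (\<Sum>U\<in>keys h. Poly_Mapping.single U (lookup h U))"
      by (simp add: lookup_contract g \<phi>_sum)
    then show ?thesis by (simp add: sum_singles)
  qed
  then have "g \<in> inverse_system J"
    using \<phi>_J by (simp add: inverse_system_ideal_iff[OF J])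
  moreover have "g \<in> degree_le a"
    using \<phi>_J mono by (auto simp: degree_le_iff g)
  moreover have "lookup g U = lookup f U" if "expo_deg U \<le> j" for U
    using \<phi>_p[OF single_deg[OF that]] by (simp add: g p_single)
  ultimately show thesis using that by blast
qed

lemma inverse_system_degree_le:
  assumes J: "\<And>U c. a < expo_deg U \<Longrightarrow> Poly_Mapping.single U c \<in> J"
  shows "inverse_system J \<subseteq> degree_le a"
proof
  fix f assume f: "f \<in> inverse_system J"
  have "lookup f U = 0" if "a < expo_deg U" for U
  proof -
    have "contract (Poly_Mapping.single U 1) f = 0"
      using f J[OF that] unfolding inverse_system_def by blast
    then show ?thesis using lookup_contract_single[of U 1 f 0] by simp
  qed
  then show "f \<in> degree_le a" by (simp add: degree_le_iff)
qed

section \<open>The inverse system of the homogenization\<close>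

text \<open>
  For \<open>d = deg h \<le> j\<close> the constant coefficient of \<open>h \<circ> f\<close> appears in \<open>h\<^sup>* \<circ> Homog j f\<close> as the
  coefficient at \<open>Z\<^bsup>[j-d]\<^esup>\<close>.  Conversely a coefficient of \<open>h\<^sup>* \<circ> Homog j f\<close> at an exponent \<open>W\<close> is the
  constant coefficient of \<open>(y\<^sup>K h) \<circ> f\<close>, where \<open>K\<close> is the affine part of \<open>W\<close>; it can be nonzero only
  if \<open>W\<close> has degree \<open>j - d\<close>, and then \<open>y\<^sup>K h\<close> has degree at most \<open>j\<close>.
\<close>

lemma Homog_in_inverse_system_iff:
  fixes f :: "('n::finite, 'k::field) dpoly"
  assumes J: "ideal.subspace J"
  shows "Homog j f \<in> inverse_system (homog_poly ` J) \<longleftrightarrow>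
    (\<forall>h\<in>J. h \<in> degree_le j \<longrightarrow> lookup (contract h f) 0 = 0)"
proof
  assume H: "Homog j f \<in> inverse_system (homog_poly ` J)"
  show "\<forall>h\<in>J. h \<in> degree_le j \<longrightarrow> lookup (contract h f) 0 = 0"
  proof (intro ballI impI)
    fix h assume h: "h \<in> J" "h \<in> degree_le j"
    let ?W = "Poly_Mapping.single None (j - poly_deg h) :: 'n option expo"
    have d: "poly_deg h \<le> j" "h \<in> degree_le (poly_deg h)"
      using h by (simp_all add: poly_deg_le_iff[symmetric])
    have "lookup (contract (homog_poly h) (Homog j f)) ?W = 0"
      using H h(1) by (simp add: inverse_system_def)
    moreover have "aff_expo ?W = 0" by (rule poly_mapping_eqI) (simp add: lookup_single)
    ultimately show "lookup (contract h f) 0 = 0"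
      using d by (simp add: homog_poly_eq_Homog lookup_contract_Homog)
  qed
next
  assume perp: "\<forall>h\<in>J. h \<in> degree_le j \<longrightarrow> lookup (contract h f) 0 = 0"
  have "contract (homog_poly h) (Homog j f) = 0" if h: "h \<in> J" for h
  proof (rule poly_mapping_eqI)
    fix W
    have d: "h \<in> degree_le (poly_deg h)" by (simp add: poly_deg_le_iff[symmetric])
    have "lookup (contract h f) (aff_expo W) = 0" if W: "expo_deg W + poly_deg h = j"
    proof -
      let ?m = "Poly_Mapping.single (aff_expo W) 1 * h"
      have "?m \<in> J" using J h by (rule ideal.subspace_scale)
      moreover have "?m \<in> degree_le j"
        unfolding degree_le_def mem_Collect_eq
      proof
        fix U assume "U \<in> keys ?m"
        then obtain V where "U = aff_expo W + V" "V \<in> keys h"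
          using keys_mult[of "Poly_Mapping.single (aff_expo W) 1" h] by (auto split: if_splits)
        then show "expo_deg U \<le> j"
          using d W expo_deg_aff[of W] by (auto simp: expo_deg_add degree_le_def)
      qed
      ultimately have "lookup (contract ?m f) 0 = 0" using perp by blast
      then show ?thesis by (simp add: contract_mult lookup_contract_single)
    qed
    then show "lookup (contract (homog_poly h) (Homog j f)) W = lookup 0 W"
      by (simp add: homog_poly_eq_Homog lookup_contract_Homog[OF d])
  qed
  then show "Homog j f \<in> inverse_system (homog_poly ` J)" by (simp add: inverse_system_def)
qed

text \<open>
  A form of degree \<open>j\<close> annihilated by the homogenization is \<open>Homog j f\<close> with \<open>f\<close> orthogonal to the
  part of \<open>J\<close> in degrees at most \<open>j\<close>.  Such an \<open>f\<close> need not be annihilated by \<open>J\<close> when \<open>j < a\<close>, but it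
  can be completed by terms of degree greater than \<open>j\<close>, which \<open>Homog j\<close> does not see.
\<close>

lemma inverse_system_homog_forms:
  fixes J :: "('n::finite, 'k::field) mpoly set"
  assumes J: "ideal.subspace J"
    and mono: "\<And>U c. a < expo_deg U \<Longrightarrow> Poly_Mapping.single U c \<in> J"
  shows "inverse_system (homog_poly ` J) \<inter> forms j = Homog j ` (inverse_system J \<inter> degree_le a)"
proof
  show "Homog j ` (inverse_system J \<inter> degree_le a) \<subseteq> inverse_system (homog_poly ` J) \<inter> forms j"
    by (auto simp: Homog_in_forms Homog_in_inverse_system_iff[OF J] inverse_system_ideal_iff[OF J])
  show "inverse_system (homog_poly ` J) \<inter> forms j \<subseteq> Homog j ` (inverse_system J \<inter> degree_le a)"
  proof
    fix F assume F: "F \<in> inverse_system (homog_poly ` J) \<inter> forms j"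
    then obtain f where f: "f \<in> degree_le j" "F = Homog j f"
      unfolding forms_eq_Homog by blast
    then have "\<forall>h\<in>J. h \<in> degree_le j \<longrightarrow> lookup (contract h f) 0 = 0"
      using F by (simp add: Homog_in_inverse_system_iff[OF J])
    then obtain g where g: "g \<in> inverse_system J \<inter> degree_le a"
      "\<And>U. expo_deg U \<le> j \<Longrightarrow> lookup g U = lookup f U"
      using inverse_system_truncation[OF J mono f(1)] by metis
    have "F = Homog j g"
    proof (rule poly_mapping_eqI)
      fix W
      show "lookup F W = lookup (Homog j g) W"
        using g(2)[of "aff_expo W"] expo_deg_aff[of W] by (simp add: f(2) lookup_Homog)
    qed
    then show "F \<in> Homog j ` (inverse_system J \<inter> degree_le a)" using g(1) by blast
  qed
qed

lemma Homog_span_eq_image: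
  "dp.subspace S \<Longrightarrow> Homog_span j S = Homog j ` S"
  unfolding Homog_span_def
  using linear_Homog module_hom.span_image[OF Vector_Spaces.module_hom_linearI] dp.span_eq_iff by metis

text \<open>Monomials of degree greater than \<open>a\<close> contract \<open>f\<close> to zero.\<close>

lemma contract_truncate:
  assumes "f \<in> degree_le a"
  obtains h' where "h' \<in> degree_le a" "contract h f = contract h' f"
proof
  define h' where "h' = (\<Sum>K\<in>{K\<in>keys h. expo_deg K \<le> a}. Poly_Mapping.single K (lookup h K))"
  have h': "lookup h' K = (if expo_deg K \<le> a then lookup h K else 0)" for K
  proof -
    have "lookup h' K = (\<Sum>V\<in>{V\<in>keys h. expo_deg V \<le> a}. if V = K then lookup h V else 0)"
      unfolding h'_def lookup_sum by (intro sum.cong) (auto simp: lookup_single when_def)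
    then show ?thesis by (auto simp: in_keys_iff)
  qed
  show "h' \<in> degree_le a" by (simp add: degree_le_iff h')
  show "contract h f = contract h' f"
  proof (rule poly_mapping_eqI)
    fix W
    have "lookup (contract h' f) W = (\<Sum>K\<in>keys h. lookup h' K * lookup f (W + K))"
      by (rule lookup_contract_superset) (auto simp: in_keys_iff h' split: if_splits)
    also have "\<dots> = (\<Sum>K\<in>keys h. lookup h K * lookup f (W + K))"
    proof (rule sum.cong)
      fix K
      have "lookup f (W + K) = 0" if "\<not> expo_deg K \<le> a"
        using assms that by (simp add: degree_le_iff expo_deg_add)
      then show "lookup h' K * lookup f (W + K) = lookup h K * lookup f (W + K)"
        by (auto simp: h')
    qed simp
    finally show "lookup (contract h f) W = lookup (contract h' f) W" by (simp add: lookup_contract)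
  qed
qed

text \<open>
  Both sides are spanned by the forms \<open>Homog j (h \<circ> f)\<close> with \<open>f \<in> V'\<close>.  On the right only \<open>h\<close> of degree
  at most \<open>a\<close> occur, because forms of degree \<open>a\<close> are homogenizations of such polynomials; larger
  degrees contribute nothing on the left.
\<close>

lemma Homog_contract_span:
  fixes V' :: "('n::finite, 'k::field) dpoly set"
  assumes V': "V' \<subseteq> degree_le a"
  shows "Homog j ` contract_span UNIV V' = contract_span (forms a) (raise_Z j ` Homog_span a V')"
proof -
  let ?G = "{contract h f | h f. h \<in> UNIV \<and> f \<in> V'}"
  have lin: "Homog i ` dp.span X = dp.span (Homog i ` X)" for i and X :: "('n, 'k) dpoly set"
    using module_hom.span_image[OF Vector_Spaces.module_hom_linearI[OF linear_Homog]] by metis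
  have spanV: "dp.span V' \<subseteq> degree_le a"
    using V' subspace_degree_le by (rule dp.span_minimal)
  have raise: "raise_Z j ` Homog_span a V' = Homog (a + j) ` dp.span V'"
  proof -
    have "raise_Z j ` Homog_span a V' = (\<lambda>f. raise_Z j (Homog a f)) ` dp.span V'"
      by (simp add: Homog_span_def lin[symmetric] image_image)
    also have "\<dots> = Homog (a + j) ` dp.span V'"
      using spanV by (intro image_cong raise_Z_Homog) auto
    finally show ?thesis .
  qed
  have gens: "{contract H F | H F. H \<in> forms a \<and> F \<in> Homog (a + j) ` dp.span V'} =
      Homog j ` {contract h f | h f. h \<in> degree_le a \<and> f \<in> dp.span V'}"
    unfolding forms_eq_Homog
  proof (intro set_eqI iffI)
    fix F assume "F \<in> {contract H F | H F. H \<in> Homog a ` degree_le a \<and> F \<in> Homog (a + j) ` dp.span V'}"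
    then obtain h f where "F = contract (Homog a h) (Homog (a + j) f)" "h \<in> degree_le a" "f \<in> dp.span V'"
      by blast
    then show "F \<in> Homog j ` {contract h f | h f. h \<in> degree_le a \<and> f \<in> dp.span V'}"
      using contract_Homog by blast
  next
    fix F assume "F \<in> Homog j ` {contract h f | h f. h \<in> degree_le a \<and> f \<in> dp.span V'}"
    then obtain h f where "F = Homog j (contract h f)" "h \<in> degree_le a" "f \<in> dp.span V'" by blast
    then have "F = contract (Homog a h) (Homog (a + j) f)" by (simp add: contract_Homog)
    then show "F \<in> {contract H F | H F. H \<in> Homog a ` degree_le a \<and> F \<in> Homog (a + j) ` dp.span V'}"
      using \<open>h \<in> degree_le a\<close> \<open>f \<in> dp.span V'\<close> by blast
  qed
  have "dp.span {contract h f | h f. h \<in> degree_le a \<and> f \<in> dp.span V'} = dp.span ?G"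
  proof (rule dp.span_eq[THEN iffD2], intro conjI subsetI)
    fix F assume "F \<in> {contract h f | h f. h \<in> degree_le a \<and> f \<in> dp.span V'}"
    then obtain h f where F: "F = contract h f" "f \<in> dp.span V'" by blast
    then have "F \<in> contract h ` dp.span V'" by blast
    also have "\<dots> = dp.span (contract h ` V')"
      using module_hom.span_image[OF Vector_Spaces.module_hom_linearI[OF linear_contract]] by metis
    also have "\<dots> \<subseteq> dp.span ?G" by (rule dp.span_mono) blast
    finally show "F \<in> dp.span ?G" .
  next
    fix F assume "F \<in> ?G"
    then obtain h f where F: "F = contract h f" "f \<in> V'" by blast
    then obtain h' where "h' \<in> degree_le a" "F = contract h' f"
      using contract_truncate[of f a h] V' by blast
    then show "F \<in> dp.span {contract h f | h f. h \<in> degree_le a \<and> f \<in> dp.span V'}"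
      using dp.span_base[OF F(2)] by (intro dp.span_base) blast
  qed
  then show ?thesis
    unfolding contract_span_def raise gens by (simp only: lin[symmetric])
qed

theorem lemma2p9:
  fixes Ip :: "('n::{finite,linorder}, 'k::field) local_ring set"
    and L' V' :: "('n, 'k) dpoly set"
    and V LZ :: "('n option, 'k) dpoly set"
    and IZ :: "('n option, 'k) mpoly set"
    and \<alpha> :: nat
  assumes "zero_dim_at_point Ip"
    and "\<alpha> = socle_degree Ip"
    and "CHAR('k) = 0 \<or> \<alpha> < CHAR('k)"
    and "L' = inverse_system (affine_ideal Ip)"
    and "V' \<subseteq> degree_le \<alpha>"
    and "L' = contract_span UNIV V'"
    and "IZ = homog_ideal Ip"
    and "V = Homog_span \<alpha> V'"
    and "LZ = inverse_system IZ"
  shows "\<forall>j. LZ \<inter> forms j = Homog_span j (L' \<inter> degree_le \<alpha>) \<and>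
             Homog_span j (L' \<inter> degree_le \<alpha>) = contract_span (forms \<alpha>) (raise_Z j ` V)"
proof (intro allI conjI)
  fix j
  have J: "ideal.subspace (affine_ideal Ip)"
    using assms(1) by (intro subspace_affine_ideal zero_dim_max_ideal(1))
  have mono: "Poly_Mapping.single U c \<in> affine_ideal Ip" if "\<alpha> < expo_deg U" for U c
    using assms(1,2) that by (intro single_in_affine_ideal) auto
  have "dp.subspace (L' \<inter> degree_le \<alpha>)"
    unfolding assms(4) by (intro dp.subspace_inter subspace_inverse_system subspace_degree_le)
  then have span: "Homog_span j (L' \<inter> degree_le \<alpha>) = Homog j ` (L' \<inter> degree_le \<alpha>)"
    by (rule Homog_span_eq_image)
  have "LZ = inverse_system (homog_poly ` affine_ideal Ip)"
    unfolding assms(9,7) homog_ideal_def by (rule inverse_system_span)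
  then show "LZ \<inter> forms j = Homog_span j (L' \<inter> degree_le \<alpha>)"
    unfolding span unfolding assms(4) using inverse_system_homog_forms[OF J mono] by simp
  have "L' \<inter> degree_le \<alpha> = contract_span UNIV V'"
    using inverse_system_degree_le[OF mono] unfolding assms(4)[symmetric] assms(6)[symmetric] by blast
  then show "Homog_span j (L' \<inter> degree_le \<alpha>) = contract_span (forms \<alpha>) (raise_Z j ` V)"
    unfolding span assms(8) using Homog_contract_span[OF assms(5)] by simp
qed

end
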